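(* Let $M\subseteq\mathbb Z\times\mathbb Z$ be a finite set of attacking moves, and let $w$ be the largest absolute value of any coordinate of any element of $M$. Let $f_q(n)$ be the number of ways to place $q$ labeled pieces on an $n\times n$ board, piece $i$ at $\mathbf x_i\in\{1,\dots,n\}^2$, such that none of them are attacking each other, where piece $i$ attacks piece $j$ ($j\ne i$) if $\mathbf x_j-\mathbf x_i\in M$. Then $f_q(n)$ is an eventual two-level polynomial of degree function $2q$ and infinite depth. Furthermore, $f_q(n)$ can be written as $$f_q(n)=n^{2q}+\sum_{\substack{r\ge2\\ r\text{ even}}}\ \sum_{t=1}^{m_r}\frac{(q)_{k_{r,t}}}{C_{r,t}}\,n^{2q-2c_{r,t}-r}\,g_{2c_{r,t}}(\mathbf a_{r,t};n),$$ where $m_r,k_{r,t},c_{r,t}\in\mathbb N$, the constants $C_{r,t}$ and the vectors $\mathbf a_{r,t}\in\mathbb N^{2c_{r,t}}$ do not depend on $q$ or $n$, and $\max_i(\mathbf a_{r,t})_i\le wr/2$; and the codegree $r$ term of this sum agrees with a two-level polynomial (of degree function $2q-r$ and infinite depth) for $n\ge wr/2$.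
   Context: $\mathbb N=\{0,1,2,\dots\}$; $(q)_k=q(q-1)\cdots(q-k+1)$. For $\mathbf a=(a_1,\dots,a_d)\in\mathbb N^d$, $g_d(\mathbf a;n)=(n-a_1)\cdots(n-a_d)$ if $n\ge\max_i a_i$, and $g_d(\mathbf a;n)=0$ otherwise. Codegree is relative to the overall degree $2q$: the codegree $r$ term is the part of the sum with index $r$. In the sum, terms with $(q)_{k_{r,t}}=0$ are zero. A numerical polynomial is $g\in\mathbb Q[x]$ with $g(q)\in\mathbb Z$ for all $q\in\mathbb Z$. Let $g$ be an eventually nonnegative numerical polynomial, $S=\{q\in\mathbb N: g(q)\ge0\}$, $e:S\to\mathbb N\cup\{-1,\infty\}$. Two-level polynomial of degree function $g$ and depth function $e$: a sequence of polynomials $\{f_q\}_{q\in S}$, with $f_q(n)$ of degree $g(q)$, such that, writing $f_q(n)=\sum_{r\ge0}c_r(q)n^{g(q)-r}$ with $c_r(q)=0$ for $r>g(q)$, there exist polynomials $\{\phi_r(q)\}_{r\ge0}$ with $c_r(q)=\phi_r(q)$ for every $q\in S$ and every $r\le e(q)$. Eventual two-level polynomial of degree function $g$ and depth function $e$: a sequence of functions $\{f_q\}_{q\in S}$, each of which agrees for sufficiently large $n$ with a polynomial of degree $g(q)$, such that, writing $f_q(n)=\sum_{r\ge0}c_r(q)n^{g(q)-r}$ for sufficiently large $n$, with $c_r(q)=0$ for $r>g(q)$, there exist polynomials $\{\phi_r(q)\}_{r\ge0}$ with $c_r(q)=\phi_r(q)$ for every $q\in S$ and every $r\le e(q)$.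 In both cases, for $q\in\mathbb N\setminus S$ one defines $f_q(n)=0$ and $e(q)=-1$; infinite depth means $e(q)=\infty$ for all $q\in S$.
   Formalization: In "two-level polynomial", "of degree g(q)" is read as degree at most g(q), since the codegree r terms can vanish (e.g. for empty M, where f_q(n)=n^{2q}); that f_q(n) agrees eventually with a polynomial of degree exactly 2q is still proved. *)

theory Defs
  imports
    "HOL-Computational_Algebra.Polynomial"
    "HOL-Library.Extended"
    "HOL-Library.FuncSet"
    "HOL-Library.Product_Plus"
begin

definition numerical_poly :: "rat poly \<Rightarrow> bool" where
  "numerical_poly g \<longleftrightarrow> (\<forall>q::int. poly g (of_int q) \<in> \<int>)"

definition degree_function :: "rat poly \<Rightarrow> bool" where
  "degree_function g \<longleftrightarrow>
     numerical_poly g \<and> (\<forall>\<^sub>F q in sequentially. 0 \<le> poly g (of_nat q))"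

definition index_set :: "rat poly \<Rightarrow> nat set" where
  "index_set g = {q. 0 \<le> poly g (of_nat q)}"

text \<open>The value \<open>g(q)\<close> as a natural number, meaningful for \<open>q\<close> in \<open>index_set g\<close>.\<close>

definition degree_at :: "rat poly \<Rightarrow> nat \<Rightarrow> nat" where
  "degree_at g q = nat \<lfloor>poly g (of_nat q)\<rfloor>"

text \<open>Depths live in \<open>\<nat> \<union> {-1, \<infinity>}\<close>; the value is \<open>-1\<close> off the index set.\<close>

definition depth_function :: "rat poly \<Rightarrow> (nat \<Rightarrow> int extended) \<Rightarrow> bool" where
  "depth_function g e \<longleftrightarrow>
     (\<forall>q\<in>index_set g. e q = Pinf \<or> (\<exists>i\<ge>-1. e q = Fin i)) \<and>
     (\<forall>q. q \<notin> index_set g \<longrightarrow> e q = Fin (-1))"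

definition infinite_depth :: "rat poly \<Rightarrow> nat \<Rightarrow> int extended" where
  "infinite_depth g q = (if q \<in> index_set g then Pinf else Fin (-1))"

text \<open>The coefficient \<open>c\<^sub>r\<close> in \<open>p = (\<Sum>r. c\<^sub>r n\<^sup>d\<^sup>-\<^sup>r)\<close>, for \<open>p\<close> of degree at most \<open>d\<close>.\<close>

definition codegree_coeff :: "nat \<Rightarrow> rat poly \<Rightarrow> nat \<Rightarrow> rat" where
  "codegree_coeff d p r = (if r \<le> d then coeff p (d - r) else 0)"

definition polynomial_codegree_coeffs ::
  "rat poly \<Rightarrow> (nat \<Rightarrow> int extended) \<Rightarrow> (nat \<Rightarrow> rat poly) \<Rightarrow> bool" where
  "polynomial_codegree_coeffs g e p \<longleftrightarrow>
     (\<exists>\<phi> :: nat \<Rightarrow> rat poly. \<forall>q\<in>index_set g. \<forall>r. Fin (int r) \<le> e q \<longrightarrow>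
        codegree_coeff (degree_at g q) (p q) r = poly (\<phi> r) (of_nat q))"

text \<open>
  ``Of degree \<open>g(q)\<close>'' is read as degree at most \<open>g(q)\<close>, so the coefficient \<open>c\<^sub>0(q)\<close> of
  \<open>n\<^sup>g\<^sup>(\<^sup>q\<^sup>)\<close> may vanish. This cannot be sharpened to equality here: for a single piece the
  count is exactly \<open>n\<^sup>2\<close>, so its term of codegree 2 is the zero polynomial although the degree
  function \<open>2q - 2\<close> takes the value 0 at \<open>q = 1\<close>.
\<close>

definition two_level_polynomial ::
  "rat poly \<Rightarrow> (nat \<Rightarrow> int extended) \<Rightarrow> (nat \<Rightarrow> rat poly) \<Rightarrow> bool" where
  "two_level_polynomial g e f \<longleftrightarrow>
     degree_function g \<and> depth_function g e \<and>
     (\<forall>q\<in>index_set g. degree (f q) \<le> degree_at g q) \<and>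
     (\<forall>q. q \<notin> index_set g \<longrightarrow> f q = 0) \<and>
     polynomial_codegree_coeffs g e f"

definition eventual_two_level_polynomial ::
  "rat poly \<Rightarrow> (nat \<Rightarrow> int extended) \<Rightarrow> (nat \<Rightarrow> nat \<Rightarrow> rat) \<Rightarrow> bool" where
  "eventual_two_level_polynomial g e f \<longleftrightarrow>
     degree_function g \<and> depth_function g e \<and>
     (\<forall>q n. q \<notin> index_set g \<longrightarrow> f q n = 0) \<and>
     (\<exists>p :: nat \<Rightarrow> rat poly.
        (\<forall>q\<in>index_set g. degree (p q) \<le> degree_at g q \<and>
           (\<forall>\<^sub>F n in sequentially. f q n = poly (p q) (of_nat n))) \<and>
        polynomial_codegree_coeffs g e p)"

text \<open>Pieces may share a square unless \<open>(0, 0) \<in> M\<close>.\<close>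

definition nonattacking_placements ::
  "(int \<times> int) set \<Rightarrow> nat \<Rightarrow> nat \<Rightarrow> (nat \<Rightarrow> int \<times> int) set" where
  "nonattacking_placements M q n =
     {x \<in> {1..q} \<rightarrow>\<^sub>E {1..int n} \<times> {1..int n}.
        \<forall>i\<in>{1..q}. \<forall>j\<in>{1..q}. j \<noteq> i \<longrightarrow> x j - x i \<notin> M}"

definition placement_count :: "(int \<times> int) set \<Rightarrow> nat \<Rightarrow> nat \<Rightarrow> rat" where
  "placement_count M q n = of_nat (card (nonattacking_placements M q n))"

text \<open>The inserted 0 only matters for empty \<open>M\<close>.\<close>

definition max_coord :: "(int \<times> int) set \<Rightarrow> nat" where
  "max_coord M = Max (insert 0 (\<Union>(u, v)\<in>M. {nat \<bar>u\<bar>, nat \<bar>v\<bar>}))"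

definition falling :: "nat \<Rightarrow> nat \<Rightarrow> rat" where
  "falling q k = (\<Prod>i<k. of_nat q - of_nat i)"

definition truncated_prod :: "nat list \<Rightarrow> nat \<Rightarrow> rat" where
  "truncated_prod as n =
     (if \<forall>a\<in>set as. a \<le> n then (\<Prod>a\<leftarrow>as. of_nat n - of_nat a) else 0)"

text \<open>
  The data are required to satisfy \<open>2 c + r \<le> 2 q\<close> whenever \<open>falling q k \<noteq> 0\<close>, so that every
  nonvanishing summand has a nonnegative exponent of \<open>n\<close> and is meaningful at \<open>n = 0\<close> too. In
  particular the terms with \<open>r > 2 q\<close> vanish, so the a priori infinite sum over \<open>r\<close> may be taken
  over \<open>r \<le> 2 q\<close>.
\<close>

definition codegree_term ::
  "(nat \<Rightarrow> nat) \<Rightarrow> (nat \<Rightarrow> nat \<Rightarrow> nat) \<Rightarrow> (nat \<Rightarrow> nat \<Rightarrow> nat) \<Rightarrow> (nat \<Rightarrow> nat \<Rightarrow> rat) \<Rightarrow>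
   (nat \<Rightarrow> nat \<Rightarrow> nat list) \<Rightarrow> nat \<Rightarrow> nat \<Rightarrow> nat \<Rightarrow> rat" where
  "codegree_term m k c C a r q n =
     (\<Sum>t = 1..m r. falling q (k r t) / C r t *
        of_nat n powi (2 * int q - 2 * int (c r t) - int r) * truncated_prod (a r t) n)"

end

theory Submission
  imports Defs
begin

text \<open>
  The proof is a cluster expansion.  Fix the positions \<open>x\<close> of the pieces and let \<open>A U\<close> be 1 or 0
  according to whether the pieces in \<open>U\<close> attack each other nowhere.  Single out one piece \<open>v\<close> of \<open>V\<close>
  and write \<open>A V = (\<Sum>B. u B * A (V - B))\<close>, summed over the subsets \<open>B\<close> of \<open>V\<close> that contain \<open>v\<close>.
  This determines the weights \<open>u B\<close> recursively (they are the Ursell functions, or cumulants, of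
  statistical mechanics), and \<open>u B\<close> vanishes as soon as \<open>B\<close> falls into two nonempty parts with no
  attack between them (\<open>ursell_split_eq_0\<close>).

  Moves have coordinates of absolute value at most \<open>w\<close>.  If in one of the two coordinates the
  pieces of \<open>B\<close> extend over more than \<open>w * (card B - 1)\<close>, then two neighbouring values of that
  coordinate differ by more than \<open>w\<close>, and cutting there makes the weight vanish
  (\<open>cluster_weight_eq_0\<close>).  So up to translation only finitely many positions of a cluster of
  \<open>j + 1\<close> pieces matter.  A shape of width \<open>a\<close> and height \<open>b\<close> has \<open>(n - a) * (n - b)\<close> translates
  inside the board, or none if it does not fit.  Hence the sum of the weights over all positions
  of the cluster is a finite combination, with coefficients independent of \<open>n\<close>, of truncated
  products with two entries that are at most \<open>w * j\<close> (\<open>cluster_sum_truncated_comb\<close>).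

  Summing over the positions turns the expansion into a recursion for the placement counts, whose
  solution is the exponential formula: choose the \<open>k\<close> pieces that lie in clusters with at least
  two members, put each of the remaining \<open>q - k\<close> pieces anywhere (a factor \<open>n\<^sup>2\<close> each), and partition
  the \<open>k\<close> pieces into \<open>c\<close> clusters (\<open>placement_count_cover_expansion\<close>).  A summand is
  \<open>(q choose k) * n ^ (2 * (q - k))\<close> times a truncated product with \<open>2 * c\<close> entries, so its codegree
  is \<open>2 * (k - c)\<close>, and its entries are at most \<open>w * (k - c)\<close>.  As all clusters have at least two
  members, \<open>2 * c \<le> k\<close>; for a given codegree only finitely many \<open>k\<close> and \<open>c\<close> occur.

  For \<open>n\<close> at least all the entries, a truncated product is a polynomial in \<open>n\<close>, and \<open>q\<close> enters the
  codegree coefficients only through the factor \<open>q choose k\<close>, which is a polynomial in \<open>q\<close>.  This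
  gives the two-level polynomials; adding up the codegrees gives the one for the whole count.
\<close>

section \<open>Ursell functions\<close>

text \<open>
  The recursion is solved for the term \<open>B' = B\<close> of \<open>A B = (\<Sum>B'. ursell A v B' * A (B - B'))\<close>, which is
  \<open>ursell A v B\<close> itself if \<open>A {} = 1\<close>.
\<close>

function ursell :: "('a set \<Rightarrow> 'b::comm_ring_1) \<Rightarrow> 'a \<Rightarrow> 'a set \<Rightarrow> 'b" where
  "ursell A v B = (if finite B
     then A B - (\<Sum>B' | v \<in> B' \<and> B' \<subset> B. ursell A v B' * A (B - B')) else 0)"
  by auto
termination
  by (relation "measure (\<lambda>(A, v, B). card B)") (auto intro: psubset_card_mono)

declare ursell.simps [simp del]

lemma ursell_expansion:
  assumes "finite V" "v \<in> V" "A {} = 1"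
  shows "A V = (\<Sum>B | v \<in> B \<and> B \<subseteq> V. ursell A v B * A (V - B))"
proof -
  have "{B. v \<in> B \<and> B \<subseteq> V} = insert V {B. v \<in> B \<and> B \<subset> V}"
    using assms(2) by auto
  moreover have "finite {B. v \<in> B \<and> B \<subset> V}"
    by (rule finite_subset[of _ "Pow V"]) (use assms(1) in auto)
  ultimately show ?thesis
    using assms by (simp add: ursell.simps[of A v V])
qed

lemma ursell_cong:
  assumes "\<And>U. U \<subseteq> B \<Longrightarrow> A U = A' U"
  shows "ursell A v B = ursell A' v B"
  using assms
proof (induction "card B" arbitrary: B rule: less_induct)
  case less
  show ?case
  proof (cases "finite B")
    case True
    have "ursell A v B' = ursell A' v B'" if "B' \<subset> B" for B'
      using less.hyps[OF psubset_card_mono[OF True that]] less.prems that by blast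
    moreover have "A (B - B') = A' (B - B')" for B'
      using less.prems by blast
    ultimately show ?thesis
      using less.prems by (simp add: ursell.simps[of _ v B] cong: conj_cong)
  qed (simp add: ursell.simps)
qed

text \<open>
  Let \<open>v\<close> lie in \<open>S\<close>.  By induction only the sets \<open>B' \<subseteq> S\<close> contribute to the recursion for
  \<open>ursell A v B\<close>, and for them \<open>A (B - B') = A (B \<inter> S - B') * A (B \<inter> T)\<close>.  So the sum is
  \<open>A (B \<inter> T)\<close> times the expansion of \<open>A (B \<inter> S)\<close>, that is \<open>A B\<close>, and nothing is left for
  \<open>ursell A v B\<close>.
\<close>

lemma ursell_split_eq_0:
  assumes "finite (S \<union> T)" "S \<inter> T = {}" "v \<in> S" "A {} = 1"
    and fact: "\<And>U. U \<subseteq> S \<union> T \<Longrightarrow> A U = A (U \<inter> S) * A (U \<inter> T)"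
    and "v \<in> B" "B \<subseteq> S \<union> T" "B \<inter> T \<noteq> {}"
  shows "ursell A v B = 0"
  using assms(6-)
proof (induction "card B" arbitrary: B rule: less_induct)
  case less
  have fin: "finite B"
    using less.prems assms(1) finite_subset by blast
  have "(\<Sum>B' | v \<in> B' \<and> B' \<subset> B. ursell A v B' * A (B - B')) =
        (\<Sum>B' | v \<in> B' \<and> B' \<subseteq> B \<inter> S. ursell A v B' * A (B - B'))"
  proof (rule sum.mono_neutral_right)
    show "\<forall>B' \<in> {B'. v \<in> B' \<and> B' \<subset> B} - {B'. v \<in> B' \<and> B' \<subseteq> B \<inter> S}.
            ursell A v B' * A (B - B') = 0"
    proof
      fix B' assume B': "B' \<in> {B'. v \<in> B' \<and> B' \<subset> B} - {B'. v \<in> B' \<and> B' \<subseteq> B \<inter> S}"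
      then have "card B' < card B"
        using fin by (auto intro: psubset_card_mono)
      moreover have "v \<in> B'" "B' \<subseteq> S \<union> T" "B' \<inter> T \<noteq> {}"
        using B' less.prems by auto
      ultimately have "ursell A v B' = 0"
        by (rule less.hyps)
      then show "ursell A v B' * A (B - B') = 0"
        by simp
    qed
    show "finite {B'. v \<in> B' \<and> B' \<subset> B}"
      by (rule finite_subset[of _ "Pow B"]) (use fin in auto)
  qed (use less.prems assms(2) in auto)
  also have "\<dots> = (\<Sum>B' | v \<in> B' \<and> B' \<subseteq> B \<inter> S. ursell A v B' * A (B \<inter> S - B') * A (B \<inter> T))"
  proof (rule sum.cong)
    fix B' assume "B' \<in> {B'. v \<in> B' \<and> B' \<subseteq> B \<inter> S}"
    then have "(B - B') \<inter> S = B \<inter> S - B'" "(B - B') \<inter> T = B \<inter> T" "B - B' \<subseteq> S \<union> T"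
      using assms(2) less.prems by auto
    then show "ursell A v B' * A (B - B') = ursell A v B' * A (B \<inter> S - B') * A (B \<inter> T)"
      using fact[of "B - B'"] by (simp add: mult.assoc)
  qed simp
  also have "\<dots> = A (B \<inter> S) * A (B \<inter> T)"
    using ursell_expansion[of "B \<inter> S" v A] fin assms(3,4) less.prems(1)
    by (simp add: sum_distrib_right)
  also have "\<dots> = A B"
    using fact less.prems(2) by simp
  finally show ?case
    using fin by (simp add: ursell.simps[of A v B])
qed

section \<open>The weight of a cluster\<close>

text \<open>
  If consecutive elements of \<open>X\<close> never differed by more than \<open>w\<close>, the \<open>card X - 1\<close> steps from the least
  to the greatest element could not cover the distance \<open>y - x\<close>.
\<close>

lemma exists_gap:
  fixes X :: "int set" and w :: nat
  assumes "finite X" "x \<in> X" "y \<in> X" "int (w * (card X - 1)) < y - x"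
  shows "\<exists>t\<in>X. (\<exists>b\<in>X. t < b) \<and> (\<forall>c\<in>X. c \<le> t \<or> t + int w < c)"
proof (rule ccontr)
  assume "\<not> ?thesis"
  then have nogap: "\<forall>t\<in>X. (\<exists>b\<in>X. t < b) \<longrightarrow> (\<exists>c\<in>X. t < c \<and> c \<le> t + int w)"
    by (metis linorder_not_le)
  have "\<forall>x\<in>X. \<forall>y\<in>X. y - x \<le> int (w * (card X - 1))"
    using \<open>finite X\<close> nogap
  proof (induction rule: finite_linorder_min_induct)
    case (insert b X)
    have ih: "y - x \<le> int (w * (card X - 1))" if "x \<in> X" "y \<in> X" for x y
    proof -
      have "\<forall>t\<in>X. (\<exists>b\<in>X. t < b) \<longrightarrow> (\<exists>c\<in>X. t < c \<and> c \<le> t + int w)"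
      proof (intro ballI impI)
        fix t assume t: "t \<in> X" "\<exists>b\<in>X. t < b"
        then obtain c where "c \<in> insert b X" "t < c" "c \<le> t + int w"
          using insert.prems by blast
        moreover have "b < t" using insert.hyps(2) t(1) by blast
        ultimately show "\<exists>c\<in>X. t < c \<and> c \<le> t + int w" by auto
      qed
      then show ?thesis
        using insert.IH that by blast
    qed
    have card: "card (insert b X) - 1 = card X"
      using insert.hyps by (subst card_insert_disjoint) auto
    have le: "w * (card X - 1) \<le> w * card X"
      by simp
    (* The new minimum b costs one more step, of length at most w, to the next element c. *)
    have b: "y - b \<le> int (w * card X)" if y: "y \<in> X" for y
    proof -
      obtain c where c: "c \<in> X" "c \<le> b + int w"
      proof -
        have "b < y" using insert.hyps(2) y by blast
        then obtain c where c: "c \<in> insert b X" "b < c" "c \<le> b + int w"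
          using insert.prems y by blast
        then have "c \<in> X" by auto
        then show thesis using c(3) by (rule that)
      qed
      have "card X \<noteq> 0"
        using y insert.hyps(1) by auto
      then have "w * card X = w + w * (card X - 1)"
        by (cases "card X") auto
      then show ?thesis
        using ih[OF c(1) y] c(2) by simp
    qed
    show ?case
      unfolding card
    proof (intro ballI)
      fix x y assume xy: "x \<in> insert b X" "y \<in> insert b X"
      consider "x = b" "y = b" | "x = b" "y \<in> X" | "x \<in> X" "y = b" | "x \<in> X" "y \<in> X"
        using xy by blast
      then show "y - x \<le> int (w * card X)"
      proof cases
        case 4
        then show ?thesis using ih[of x y] le by linarith
      qed (use b insert.hyps(2) in force)+
    qed
  qed simp
  then show False
    using assms by force
qed

definition attack_free :: "(int \<times> int) set \<Rightarrow> (nat \<Rightarrow> int \<times> int) \<Rightarrow> nat set \<Rightarrow> bool" where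
  "attack_free M x U \<longleftrightarrow> (\<forall>i\<in>U. \<forall>j\<in>U. j \<noteq> i \<longrightarrow> x j - x i \<notin> M)"

abbreviation cluster_weight :: "(int \<times> int) set \<Rightarrow> nat \<Rightarrow> nat set \<Rightarrow> (nat \<Rightarrow> int \<times> int) \<Rightarrow> rat" where
  "cluster_weight M v B x \<equiv> ursell (\<lambda>U. of_bool (attack_free M x U)) v B"

lemma attack_free_empty [simp]: "attack_free M x {}"
  by (simp add: attack_free_def)

text \<open>
  The weight depends only on the differences of positions within \<open>B\<close>: it is invariant under
  translation, and it ignores the pieces outside \<open>B\<close>.
\<close>

lemma cluster_weight_cong:
  assumes "\<And>i j. i \<in> B \<Longrightarrow> j \<in> B \<Longrightarrow> x j - x i = y j - y i"
  shows "cluster_weight M v B x = cluster_weight M v B y"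
proof (rule ursell_cong)
  fix U assume "U \<subseteq> B"
  then have "attack_free M x U = attack_free M y U"
    unfolding attack_free_def using assms by (metis subsetD)
  then show "of_bool (attack_free M x U) = (of_bool (attack_free M y U) :: rat)"
    by simp
qed

text \<open>
  For \<open>coord\<close> one takes \<open>fst\<close> or \<open>snd\<close>.  A gap of more than \<open>w\<close> between the coordinates of the pieces
  separates them into two parts, and no move bridges the gap in either direction.
\<close>

lemma cluster_weight_eq_0:
  fixes coord :: "int \<times> int \<Rightarrow> int" and w :: nat
  assumes coord: "\<And>d d'. coord (d - d') = coord d - coord d'"
    and w: "\<And>d. d \<in> M \<Longrightarrow> \<bar>coord d\<bar> \<le> int w"
    and B: "finite B" "v \<in> B" "i \<in> B" "j \<in> B"
    and far: "int (w * (card B - 1)) < coord (x j - x i)"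
  shows "cluster_weight M v B x = 0"
proof -
  let ?c = "\<lambda>i. coord (x i)"
  let ?A = "\<lambda>U. of_bool (attack_free M x U) :: rat"
  have "card (?c ` B) \<le> card B"
    using B(1) by (rule card_image_le)
  then have "w * (card (?c ` B) - 1) \<le> w * (card B - 1)"
    by (intro mult_le_mono) auto
  then have "int (w * (card (?c ` B) - 1)) < ?c j - ?c i"
    using far coord by (smt (verit) of_nat_mono)
  then obtain t where t: "t \<in> ?c ` B" "\<exists>b\<in>?c ` B. t < b"
      "\<forall>c\<in>?c ` B. c \<le> t \<or> t + int w < c"
    using exists_gap[of "?c ` B" "?c i" "?c j" w] B by blast
  define S where "S = {i \<in> B. ?c i \<le> t}"
  define T where "T = {i \<in> B. t + int w < ?c i}"
  have ST: "S \<union> T = B" "S \<inter> T = {}" "S \<noteq> {}" "T \<noteq> {}"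
    using t unfolding S_def T_def by force+
  have cross: "x j - x i \<notin> M \<and> x i - x j \<notin> M" if "i \<in> S" "j \<in> T" for i j
    using that w[of "x j - x i"] w[of "x i - x j"] unfolding S_def T_def by (auto simp: coord)
  have split: "?A U = ?A (U \<inter> S) * ?A (U \<inter> T)" if "U \<subseteq> S \<union> T" for U
  proof -
    have "attack_free M x U \<longleftrightarrow> attack_free M x (U \<inter> S) \<and> attack_free M x (U \<inter> T)"
      unfolding attack_free_def using cross that by blast
    then show ?thesis by simp
  qed
  have split': "?A U = ?A (U \<inter> T) * ?A (U \<inter> S)" if "U \<subseteq> T \<union> S" for U
    using split[of U] that by (simp add: Un_commute mult.commute)
  consider "v \<in> S" | "v \<in> T" using ST B by blast
  then show ?thesis
  proof cases
    case 1
    show ?thesis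
      by (rule ursell_split_eq_0[of S T]) (use 1 ST B split in auto)
  next
    case 2
    show ?thesis
      by (rule ursell_split_eq_0[of T S]) (use 2 ST B split' in auto)
  qed
qed

section \<open>Summing over the board\<close>

lemma sum_PiE_disjoint_Un:
  fixes f g :: "('a \<Rightarrow> 'b) \<Rightarrow> 'c::comm_semiring_0"
  assumes "B \<inter> C = {}"
  shows "(\<Sum>x\<in>(B \<union> C) \<rightarrow>\<^sub>E X. f (restrict x B) * g (restrict x C)) =
    (\<Sum>x\<in>B \<rightarrow>\<^sub>E X. f x) * (\<Sum>x\<in>C \<rightarrow>\<^sub>E X. g x)"
proof -
  define glue :: "('a \<Rightarrow> 'b) \<times> ('a \<Rightarrow> 'b) \<Rightarrow> 'a \<Rightarrow> 'b"
    where "glue = (\<lambda>(y, z) i. if i \<in> B then y i else z i)"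
  have "(\<Sum>x\<in>(B \<union> C) \<rightarrow>\<^sub>E X. f (restrict x B) * g (restrict x C)) =
      (\<Sum>(y, z)\<in>(B \<rightarrow>\<^sub>E X) \<times> (C \<rightarrow>\<^sub>E X). f y * g z)"
  proof (rule sum.reindex_bij_witness[where j = "\<lambda>x. (restrict x B, restrict x C)" and i = glue])
    fix x assume x: "x \<in> (B \<union> C) \<rightarrow>\<^sub>E X"
    show "glue (restrict x B, restrict x C) = x"
    proof
      fix i show "glue (restrict x B, restrict x C) i = x i"
        using PiE_arb[OF x, of i] by (simp add: glue_def)
    qed
    show "(restrict x B, restrict x C) \<in> (B \<rightarrow>\<^sub>E X) \<times> (C \<rightarrow>\<^sub>E X)"
      using PiE_mem[OF x] by simp
  next
    fix yz assume "yz \<in> (B \<rightarrow>\<^sub>E X) \<times> (C \<rightarrow>\<^sub>E X)"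
    then obtain y z where yz: "yz = (y, z)" "y \<in> B \<rightarrow>\<^sub>E X" "z \<in> C \<rightarrow>\<^sub>E X" by blast
    have "restrict (glue yz) B = y"
    proof
      fix i show "restrict (glue yz) B i = y i"
        using PiE_arb[OF yz(2), of i] by (simp add: glue_def yz(1))
    qed
    moreover have "restrict (glue yz) C = z"
    proof
      fix i
      have "i \<in> C \<Longrightarrow> i \<notin> B" using assms by blast
      then show "restrict (glue yz) C i = z i"
        using PiE_arb[OF yz(3), of i] by (simp add: glue_def yz(1))
    qed
    ultimately show "(restrict (glue yz) B, restrict (glue yz) C) = yz"
      using yz by simp
    show "glue yz \<in> B \<union> C \<rightarrow>\<^sub>E X"
      using PiE_mem[OF yz(2)] PiE_mem[OF yz(3)] PiE_arb[OF yz(3)]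
      by (intro PiE_I) (auto simp: glue_def yz(1))
  qed simp
  then show ?thesis
    by (simp add: sum_product sum.cartesian_product)
qed

lemma sum_psubsets_card:
  fixes g :: "nat \<Rightarrow> 'b::comm_semiring_1"
  assumes "finite X"
  shows "(\<Sum>B | B \<subset> X. g (card B)) = (\<Sum>j<card X. of_nat (card X choose j) * g j)"
proof -
  have fin: "finite {B. B \<subset> X}"
    by (rule finite_subset[of _ "Pow X"]) (use assms in auto)
  have "(\<Sum>B | B \<subset> X. g (card B)) =
      (\<Sum>j<card X. \<Sum>B\<in>{B \<in> {B. B \<subset> X}. card B = j}. g (card B))"
    by (rule sum.group[symmetric]) (use fin assms psubset_card_mono in auto)
  also have "\<dots> = (\<Sum>j<card X. of_nat (card X choose j) * g j)"
  proof (rule sum.cong)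
    fix j assume "j \<in> {..<card X}"
    then have "{B \<in> {B. B \<subset> X}. card B = j} = {B. B \<subseteq> X \<and> card B = j}"
      by auto
    then show "(\<Sum>B\<in>{B \<in> {B. B \<subset> X}. card B = j}. g (card B)) = of_nat (card X choose j) * g j"
      using n_subsets[OF assms, of j] by simp
  qed simp
  finally show ?thesis .
qed

abbreviation board :: "nat \<Rightarrow> (int \<times> int) set" where
  "board n \<equiv> {1..int n} \<times> {1..int n}"

text \<open>
  A bijection between \<open>V\<close> and \<open>{1..q}\<close> relabels the pieces; the board and the moves do not notice.
\<close>

lemma placement_count_eq_sum:
  assumes "finite V" "card V = q"
  shows "(\<Sum>x\<in>V \<rightarrow>\<^sub>E board n. of_bool (attack_free M x V)) = placement_count M q n"
proof -
  obtain h where h: "bij_betw h {1..q} V"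
    using assms by (metis bij_betw_iff_card card_atLeastAtMost diff_Suc_1 finite_atLeastAtMost)
  let ?h' = "inv_into {1..q} h"
  have h': "bij_betw ?h' V {1..q}"
    using h by (rule bij_betw_inv_into)
  have hm: "h i \<in> V" if "i \<in> {1..q}" for i using h that by (rule bij_betwE[rule_format])
  have hm': "?h' i \<in> {1..q}" if "i \<in> V" for i using h' that by (rule bij_betwE[rule_format])
  have hh: "h (?h' i) = i" if "i \<in> V" for i
    using h that by (rule bij_betw_inv_into_right)
  have hh': "?h' (h i) = i" if "i \<in> {1..q}" for i
    using h that by (rule bij_betw_inv_into_left)
  have "(\<Sum>x\<in>V \<rightarrow>\<^sub>E board n. of_bool (attack_free M x V)) =
      (\<Sum>x\<in>{1..q} \<rightarrow>\<^sub>E board n. of_bool (attack_free M x {1..q}) :: rat)"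
  proof (rule sum.reindex_bij_witness[where j = "\<lambda>x. restrict (x \<circ> h) {1..q}"
        and i = "\<lambda>x. restrict (x \<circ> ?h') V"])
    fix x assume x: "x \<in> V \<rightarrow>\<^sub>E board n"
    show "restrict (restrict (x \<circ> h) {1..q} \<circ> ?h') V = x"
    proof
      fix i show "restrict (restrict (x \<circ> h) {1..q} \<circ> ?h') V i = x i"
        using hm' hh PiE_arb[OF x] by (cases "i \<in> V") simp_all
    qed
    show "restrict (x \<circ> h) {1..q} \<in> {1..q} \<rightarrow>\<^sub>E board n"
      using PiE_mem[OF x hm] by (intro PiE_I) auto
    have V: "V = h ` {1..q}" using h by (simp add: bij_betw_imp_surj_on)
    have inj: "inj_on h {1..q}" using h by (rule bij_betw_imp_inj_on)
    have "attack_free M (restrict (x \<circ> h) {1..q}) {1..q} = attack_free M x V"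
      unfolding attack_free_def V
      by (simp add: inj_on_eq_iff[OF inj] del: atLeastAtMost_iff cong: ball_cong)
    then show "of_bool (attack_free M (restrict (x \<circ> h) {1..q}) {1..q}) =
        (of_bool (attack_free M x V) :: rat)" by simp
  next
    fix x assume x: "x \<in> {1..q} \<rightarrow>\<^sub>E board n"
    show "restrict (restrict (x \<circ> ?h') V \<circ> h) {1..q} = x"
    proof
      fix i show "restrict (restrict (x \<circ> ?h') V \<circ> h) {1..q} i = x i"
        using hm hh' PiE_arb[OF x] by (cases "i \<in> {1..q}") (simp_all del: atLeastAtMost_iff)
    qed
    show "restrict (x \<circ> ?h') V \<in> V \<rightarrow>\<^sub>E board n"
      using PiE_mem[OF x hm'] by (intro PiE_I) auto
  qed
  also have "\<dots> = placement_count M q n"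
  proof -
    have "finite ({1..q} \<rightarrow>\<^sub>E board n)"
      by (intro finite_PiE) auto
    then show ?thesis
      unfolding placement_count_def nonattacking_placements_def attack_free_def
      by (subst sum_of_bool_eq) (simp_all only: Int_def mem_Collect_eq)
  qed
  finally show ?thesis .
qed

text \<open>
  The sum of the weights of a cluster of \<open>j + 1\<close> pieces over all its positions on the board
  (\<open>sum_cluster_weight\<close>).  It is defined through the recursion that it has to satisfy, because this
  makes it evident that it depends on the number of pieces only.  The distinguished piece is
  not counted in \<open>j\<close>: the coefficient \<open>j choose i\<close> counts the choices of the \<open>i\<close> other members of a
  smaller cluster.
\<close>

fun cluster_sum :: "(int \<times> int) set \<Rightarrow> nat \<Rightarrow> nat \<Rightarrow> rat" where
  "cluster_sum M j n = placement_count M (Suc j) n -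
     (\<Sum>i<j. of_nat (j choose i) * (cluster_sum M i n * placement_count M (j - i) n))"

declare cluster_sum.simps [simp del]

lemma placement_count_0 [simp]: "placement_count M 0 n = 1"
proof -
  have "placement_count M 0 n = (\<Sum>x\<in>{} \<rightarrow>\<^sub>E board n. of_bool (attack_free M x {}))"
    by (rule placement_count_eq_sum[symmetric]) simp_all
  then show ?thesis
    by (simp only: PiE_empty_domain) simp
qed

lemma placement_count_Suc:
  "placement_count M (Suc q) n =
     (\<Sum>j\<le>q. of_nat (q choose j) * (cluster_sum M j n * placement_count M (q - j) n))"
proof -
  let ?t = "\<lambda>j. of_nat (q choose j) * (cluster_sum M j n * placement_count M (q - j) n)"
  have "{..q} = insert q {..<q}" by auto
  then have "(\<Sum>j\<le>q. ?t j) = cluster_sum M q n + (\<Sum>j<q. ?t j)" by simp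
  then show ?thesis
    using cluster_sum.simps[of M q n] by linarith
qed

text \<open>
  Summing \<open>ursell_expansion\<close> over all positions separates, for each \<open>B\<close>, into the positions of the
  cluster \<open>B\<close> and a placement of the pieces outside \<open>B\<close>.  By induction every term except that of
  \<open>B = V\<close> is known, and this is the recursion that defines \<open>cluster_sum\<close>.
\<close>

lemma sum_cluster_weight:
  assumes "finite V" "v \<in> V"
  shows "(\<Sum>x\<in>V \<rightarrow>\<^sub>E board n. cluster_weight M v V x) = cluster_sum M (card V - 1) n"
  using assms
proof (induction "card V" arbitrary: V rule: less_induct)
  case less
  define q where "q = card V - 1"
  have card: "card V = Suc q" "card (V - {v}) = q"
    using less.prems card_Suc_Diff1[of V v] by (auto simp: q_def)
  let ?W = "\<lambda>B. \<Sum>x\<in>B \<rightarrow>\<^sub>E board n. cluster_weight M v B x"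
  let ?Z = "\<lambda>B. \<Sum>x\<in>B \<rightarrow>\<^sub>E board n. of_bool (attack_free M x B) :: rat"
  have fin: "finite {B. v \<in> B \<and> B \<subseteq> V}" "finite {B. v \<in> B \<and> B \<subset> V}"
    by (rule finite_subset[of _ "Pow V"]; use less.prems in auto)+
  have "placement_count M (Suc q) n = ?Z V"
    by (rule placement_count_eq_sum[symmetric]) (use less.prems card in auto)
  also have "\<dots> = (\<Sum>x\<in>V \<rightarrow>\<^sub>E board n. \<Sum>B | v \<in> B \<and> B \<subseteq> V.
      cluster_weight M v B x * of_bool (attack_free M x (V - B)))"
    by (intro sum.cong refl ursell_expansion) (use less.prems in auto)
  also have "\<dots> = (\<Sum>B | v \<in> B \<and> B \<subseteq> V. \<Sum>x\<in>V \<rightarrow>\<^sub>E board n.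
      cluster_weight M v B x * of_bool (attack_free M x (V - B)))"
    by (rule sum.swap)
  also have "\<dots> = (\<Sum>B | v \<in> B \<and> B \<subseteq> V. ?W B * ?Z (V - B))"
  proof (rule sum.cong)
    fix B assume B: "B \<in> {B. v \<in> B \<and> B \<subseteq> V}"
    have "(\<Sum>x\<in>V \<rightarrow>\<^sub>E board n. cluster_weight M v B x * of_bool (attack_free M x (V - B))) =
        (\<Sum>x\<in>(B \<union> (V - B)) \<rightarrow>\<^sub>E board n. cluster_weight M v B (restrict x B) *
           of_bool (attack_free M (restrict x (V - B)) (V - B)))"
    proof (rule sum.cong)
      show "(V \<rightarrow>\<^sub>E board n) = ((B \<union> (V - B)) \<rightarrow>\<^sub>E board n)"
        using B by (intro arg_cong[where f = "\<lambda>V. V \<rightarrow>\<^sub>E board n"]) auto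
    next
      fix x
      have "cluster_weight M v B x = cluster_weight M v B (restrict x B)"
        by (rule cluster_weight_cong) simp
      moreover have "attack_free M (restrict x (V - B)) (V - B) = attack_free M x (V - B)"
        by (simp add: attack_free_def)
      ultimately show "cluster_weight M v B x * of_bool (attack_free M x (V - B)) =
        cluster_weight M v B (restrict x B) *
           of_bool (attack_free M (restrict x (V - B)) (V - B))" by simp
    qed
    also have "\<dots> = ?W B * ?Z (V - B)"
      by (rule sum_PiE_disjoint_Un) auto
    finally show "(\<Sum>x\<in>V \<rightarrow>\<^sub>E board n. cluster_weight M v B x *
        of_bool (attack_free M x (V - B))) = ?W B * ?Z (V - B)" .
  qed simp
  also have "{B. v \<in> B \<and> B \<subseteq> V} = insert V {B. v \<in> B \<and> B \<subset> V}"
    using less.prems by auto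
  also have "(\<Sum>B\<in>insert V {B. v \<in> B \<and> B \<subset> V}. ?W B * ?Z (V - B)) =
      ?W V + (\<Sum>B | v \<in> B \<and> B \<subset> V. ?W B * ?Z (V - B))"
    using fin(2) by simp
  also have "(\<Sum>B | v \<in> B \<and> B \<subset> V. ?W B * ?Z (V - B)) =
      (\<Sum>B | v \<in> B \<and> B \<subset> V. cluster_sum M (card B - 1) n * placement_count M (card V - card B) n)"
  proof (rule sum.cong)
    fix B assume B: "B \<in> {B. v \<in> B \<and> B \<subset> V}"
    then have fB: "finite B" using less.prems finite_subset by blast
    have "?W B = cluster_sum M (card B - 1) n"
      by (rule less.hyps) (use B fB less.prems psubset_card_mono in auto)
    moreover have "?Z (V - B) = placement_count M (card V - card B) n"
      by (rule placement_count_eq_sum) (use B fB less.prems card_Diff_subset in auto)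
    ultimately show "?W B * ?Z (V - B) =
        cluster_sum M (card B - 1) n * placement_count M (card V - card B) n"
      by (simp only:)
  qed simp
  (* The sets B that contain v are counted by their remaining elements. *)
  also have "\<dots> = (\<Sum>B | B \<subset> V - {v}. cluster_sum M (card B) n * placement_count M (q - card B) n)"
  proof (rule sum.reindex_bij_witness[where j = "\<lambda>B. B - {v}" and i = "insert v"])
    fix B assume B: "B \<in> {B. v \<in> B \<and> B \<subset> V}"
    then have "finite B" using less.prems finite_subset by blast
    then have "card (B - {v}) = card B - 1" "card B \<noteq> 0"
      using B by auto
    then show "cluster_sum M (card (B - {v})) n * placement_count M (q - card (B - {v})) n =
       cluster_sum M (card B - 1) n * placement_count M (card V - card B) n"
      using card by simp
  qed (use less.prems in auto)
  also have "\<dots> = (\<Sum>j<q. of_nat (q choose j) * (cluster_sum M j n * placement_count M (q - j) n))"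
    using sum_psubsets_card[of "V - {v}" "\<lambda>j. cluster_sum M j n * placement_count M (q - j) n"]
      less.prems card by simp
  finally show ?case
    unfolding card diff_Suc_1 using cluster_sum.simps[of M q n] by linarith
qed

section \<open>Combinations of truncated products\<close>

text \<open>
  Zero coefficients are excluded because the coefficients are later written as fractions with a
  nonzero constant \<open>C\<close> in the denominator.
\<close>

inductive truncated_comb :: "nat \<Rightarrow> nat \<Rightarrow> (nat \<Rightarrow> rat) \<Rightarrow> bool" for b c where
  zero: "truncated_comb b c (\<lambda>n. 0)"
| step: "s \<noteq> 0 \<Longrightarrow> length as = 2 * c \<Longrightarrow> \<forall>a\<in>set as. a \<le> b \<Longrightarrow> truncated_comb b c F \<Longrightarrow>
    truncated_comb b c (\<lambda>n. s * truncated_prod as n + F n)"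

lemma truncated_prod_append:
  "truncated_prod (as @ bs) n = truncated_prod as n * truncated_prod bs n"
  by (auto simp: truncated_prod_def)

lemma truncated_comb_generator:
  assumes "length as = 2 * c" "\<forall>a\<in>set as. a \<le> b"
  shows "truncated_comb b c (\<lambda>n. s * truncated_prod as n)"
  using truncated_comb.step[OF _ assms truncated_comb.zero, of s] truncated_comb.zero[of b c]
  by (cases "s = 0") auto

lemma truncated_comb_add:
  assumes "truncated_comb b c F" "truncated_comb b c G"
  shows "truncated_comb b c (\<lambda>n. F n + G n)"
  using assms(1)
proof induction
  case (step s as F)
  then show ?case
    using truncated_comb.step[OF step.hyps(1-3) step.IH] by (simp add: add.assoc)
qed (use assms(2) in simp)

lemma truncated_comb_sum:
  assumes "\<And>i. i \<in> I \<Longrightarrow> truncated_comb b c (F i)"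
  shows "truncated_comb b c (\<lambda>n. \<Sum>i\<in>I. F i n)"
  using assms
  by (induction I rule: infinite_finite_induct)
    (auto intro: truncated_comb.zero truncated_comb_add)

lemma truncated_comb_mono:
  assumes "truncated_comb b c F" "b \<le> b'"
  shows "truncated_comb b' c F"
  using assms(1)
  by induction (use assms(2) in \<open>fastforce intro: truncated_comb.intros\<close>)+

lemma truncated_comb_cmult:
  assumes "truncated_comb b c F"
  shows "truncated_comb b c (\<lambda>n. s * F n)"
  using assms
proof induction
  case (step s' as F)
  then show ?case
    using truncated_comb_add[OF truncated_comb_generator[OF step.hyps(2,3), of "s * s'"] step.IH]
    by (simp add: algebra_simps)
qed (use truncated_comb.zero in simp)

lemma truncated_comb_mult_generator:
  assumes "length as = 2 * c" "\<forall>a\<in>set as. a \<le> b" "truncated_comb b c' G"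
  shows "truncated_comb b (c + c') (\<lambda>n. truncated_prod as n * G n)"
  using assms(3)
proof induction
  case (step s bs G)
  have "truncated_comb b (c + c') (\<lambda>n. s * truncated_prod (as @ bs) n)"
    by (rule truncated_comb_generator) (use step.hyps assms in auto)
  from truncated_comb_add[OF this step.IH] show ?case
    by (simp add: algebra_simps truncated_prod_append)
qed (use truncated_comb.zero in simp)

lemma truncated_comb_mult:
  assumes "truncated_comb b c F" "truncated_comb b c' G"
  shows "truncated_comb b (c + c') (\<lambda>n. F n * G n)"
  using assms(1)
proof induction
  case (step s as F)
  from truncated_comb_add[OF truncated_comb_cmult[OF
      truncated_comb_mult_generator[OF step.hyps(2,3) assms(2)], of s] step.IH]
  show ?case by (simp add: algebra_simps)
qed (use truncated_comb.zero in simp)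

lemma truncated_comb_imp_list:
  assumes "truncated_comb b c F"
  shows "\<exists>L. (\<forall>(s, as)\<in>set L. s \<noteq> 0 \<and> length as = 2 * c \<and> (\<forall>a\<in>set as. a \<le> b)) \<and>
    (\<forall>n. F n = (\<Sum>(s, as)\<leftarrow>L. s * truncated_prod as n))"
  using assms
proof induction
  case (step s as F)
  then obtain L where "\<forall>(s, as)\<in>set L. s \<noteq> 0 \<and> length as = 2 * c \<and> (\<forall>a\<in>set as. a \<le> b)"
      "\<forall>n. F n = (\<Sum>(s, as)\<leftarrow>L. s * truncated_prod as n)" by blast
  with step.hyps show ?case
    by (intro exI[of _ "(s, as) # L"]) auto
qed (auto intro: exI[of _ "[]"])

lemma max_coord_ge:
  assumes "finite M" "d \<in> M"
  shows "\<bar>fst d\<bar> \<le> int (max_coord M)" "\<bar>snd d\<bar> \<le> int (max_coord M)"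
proof -
  let ?X = "insert 0 (\<Union>(u, v)\<in>M. {nat \<bar>u\<bar>, nat \<bar>v\<bar>})"
  have "finite ?X" using assms(1) by auto
  moreover have "nat \<bar>fst d\<bar> \<in> ?X" "nat \<bar>snd d\<bar> \<in> ?X" using assms(2) by (cases d; force)+
  ultimately have "nat \<bar>fst d\<bar> \<le> max_coord M" "nat \<bar>snd d\<bar> \<le> max_coord M"
    unfolding max_coord_def by (auto intro: Max_ge)
  then show "\<bar>fst d\<bar> \<le> int (max_coord M)" "\<bar>snd d\<bar> \<le> int (max_coord M)" by auto
qed

section \<open>Cluster sums as truncated products\<close>

lemma card_common_translates:
  fixes X :: "int set"
  assumes "finite X" "X \<noteq> {}"
  shows "card {p. \<forall>x\<in>X. x + p \<in> {1..int n}} = n - nat (Max X - Min X)"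
proof -
  have "{p. \<forall>x\<in>X. x + p \<in> {1..int n}} = {1 - Min X..int n - Max X}"
  proof (intro set_eqI iffI)
    fix p assume "p \<in> {p. \<forall>x\<in>X. x + p \<in> {1..int n}}"
    then have "Min X + p \<in> {1..int n}" "Max X + p \<in> {1..int n}"
      using Max_in[OF assms] Min_in[OF assms] by blast+
    then show "p \<in> {1 - Min X..int n - Max X}" by auto
  next
    fix p assume p: "p \<in> {1 - Min X..int n - Max X}"
    have "x + p \<in> {1..int n}" if "x \<in> X" for x
      using Min_le[OF assms(1) that] Max_ge[OF assms(1) that] p by simp
    then show "p \<in> {p. \<forall>x\<in>X. x + p \<in> {1..int n}}" by blast
  qed
  moreover have "Min X \<le> Max X"
    using Min_le[OF assms(1) Max_in[OF assms]] .
  ultimately show ?thesis by (simp only: card_atLeastAtMost_int)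
qed

text \<open>
  Positions are grouped by their shape, the position relative to piece 0.  A shape of nonzero weight
  lies in a bounded region, so that there are finitely many of them, and a position of given shape is
  determined by the square of piece 0.
\<close>

lemma cluster_sum_truncated_comb:
  assumes "finite M"
  shows "truncated_comb (max_coord M * j) 1 (cluster_sum M j)"
proof -
  define D where "D = max_coord M * j"
  define V where "V = {..j}"
  have V: "finite V" "0 \<in> V" "V \<noteq> {}" "card V = Suc j"
    by (auto simp: V_def)
  define Y where "Y = {y \<in> V \<rightarrow>\<^sub>E {-int D..int D} \<times> {-int D..int D}.
    y 0 = 0 \<and> (\<forall>i\<in>V. \<forall>k\<in>V. fst (y k - y i) \<le> int D \<and> snd (y k - y i) \<le> int D)}"
  have "finite (V \<rightarrow>\<^sub>E {-int D..int D} \<times> {-int D..int D})"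
    using V by (intro finite_PiE) auto
  then have finY: "finite Y" unfolding Y_def by simp
  define shape where "shape x = (\<lambda>i\<in>V. x i - x 0)" for x :: "nat \<Rightarrow> int \<times> int"
  define a where "a y = nat (Max (fst ` y ` V) - Min (fst ` y ` V))" for y :: "nat \<Rightarrow> int \<times> int"
  define b where "b y = nat (Max (snd ` y ` V) - Min (snd ` y ` V))" for y :: "nat \<Rightarrow> int \<times> int"
  have finX: "finite (V \<rightarrow>\<^sub>E board n)" for n
    using V by (intro finite_PiE) auto
  have span: "a y \<le> D" "b y \<le> D" if "y \<in> Y" for y
  proof -
    have y: "\<forall>i\<in>V. \<forall>k\<in>V. fst (y k) - fst (y i) \<le> int D \<and> snd (y k) - snd (y i) \<le> int D"
      using that unfolding Y_def by simp
    have "Max (fst ` y ` V) \<in> fst ` y ` V" "Min (fst ` y ` V) \<in> fst ` y ` V"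
      using V by (intro Max_in Min_in; simp)+
    then have "Max (fst ` y ` V) - Min (fst ` y ` V) \<le> int D"
      using y by force
    then show "a y \<le> D" unfolding a_def by simp
    have "Max (snd ` y ` V) \<in> snd ` y ` V" "Min (snd ` y ` V) \<in> snd ` y ` V"
      using V by (intro Max_in Min_in; simp)+
    then have "Max (snd ` y ` V) - Min (snd ` y ` V) \<le> int D"
      using y by force
    then show "b y \<le> D" unfolding b_def by simp
  qed
  have fibre: "of_nat (card {x \<in> V \<rightarrow>\<^sub>E board n. shape x = y}) = truncated_prod [a y, b y] n"
    if y: "y \<in> Y" for y n
  proof -
    let ?P = "{p. \<forall>x\<in>fst ` y ` V. x + p \<in> {1..int n}}"
    let ?Q = "{p. \<forall>x\<in>snd ` y ` V. x + p \<in> {1..int n}}"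
    have y0: "y 0 = 0" and yext: "y \<in> extensional V"
      using y unfolding Y_def by (auto simp: PiE_iff)
    (* The square of piece 0 ranges over a product of two intervals. *)
    have "bij_betw (\<lambda>x. x 0) {x \<in> V \<rightarrow>\<^sub>E board n. shape x = y} (?P \<times> ?Q)"
    proof (rule bij_betw_byWitness[where f' = "\<lambda>p. \<lambda>i\<in>V. y i + p"])
      have x_eq: "x i = y i + x 0" if "x \<in> V \<rightarrow>\<^sub>E board n" "shape x = y" "i \<in> V" for x i
        using that by (auto simp: shape_def)
      show "\<forall>x\<in>{x \<in> V \<rightarrow>\<^sub>E board n. shape x = y}. (\<lambda>i\<in>V. y i + x 0) = x"
      proof
        fix x assume x: "x \<in> {x \<in> V \<rightarrow>\<^sub>E board n. shape x = y}"
        show "(\<lambda>i\<in>V. y i + x 0) = x"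
        proof
          fix i show "(\<lambda>i\<in>V. y i + x 0) i = x i"
            using x x_eq[of x i] PiE_arb[of x V "\<lambda>_. board n" i] by (cases "i \<in> V") simp_all
        qed
      qed
      show "\<forall>p\<in>?P \<times> ?Q. (\<lambda>i\<in>V. y i + p) 0 = p"
        using V(2) y0 by simp
      show "(\<lambda>x. x 0) ` {x \<in> V \<rightarrow>\<^sub>E board n. shape x = y} \<subseteq> ?P \<times> ?Q"
      proof
        fix p assume "p \<in> (\<lambda>x. x 0) ` {x \<in> V \<rightarrow>\<^sub>E board n. shape x = y}"
        then obtain x where x: "x \<in> V \<rightarrow>\<^sub>E board n" "shape x = y" "p = x 0" by blast
        have "y i + p \<in> board n" if "i \<in> V" for i
          using x_eq[OF x(1,2) that] PiE_mem[OF x(1) that] x(3) by simp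
        then have "fst (y i) + fst p \<in> {1..int n} \<and> snd (y i) + snd p \<in> {1..int n}"
          if "i \<in> V" for i
          using that by (fastforce simp: mem_Times_iff)
        then show "p \<in> ?P \<times> ?Q"
          unfolding mem_Times_iff by blast
      qed
      show "(\<lambda>p. \<lambda>i\<in>V. y i + p) ` (?P \<times> ?Q) \<subseteq> {x \<in> V \<rightarrow>\<^sub>E board n. shape x = y}"
      proof
        fix x assume "x \<in> (\<lambda>p. \<lambda>i\<in>V. y i + p) ` (?P \<times> ?Q)"
        then obtain p where p: "p \<in> ?P \<times> ?Q" "x = (\<lambda>i\<in>V. y i + p)" by blast
        have "y i + p \<in> board n" if "i \<in> V" for i
          using p(1) that by (auto simp: mem_Times_iff)
        then have "x \<in> V \<rightarrow>\<^sub>E board n" using p(2) by (intro PiE_I) auto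
        moreover have "shape x = y"
        proof
          fix i show "shape x i = y i"
            using y0 V(2) extensional_arb[OF yext, of i]
            unfolding shape_def p(2) by (cases "i \<in> V") simp_all
        qed
        ultimately show "x \<in> {x \<in> V \<rightarrow>\<^sub>E board n. shape x = y}" by blast
      qed
    qed
    then have "card {x \<in> V \<rightarrow>\<^sub>E board n. shape x = y} = card ?P * card ?Q"
      by (simp only: bij_betw_same_card[of _ _ "?P \<times> ?Q"] card_cartesian_product)
    also have "\<dots> = (n - a y) * (n - b y)"
      unfolding a_def b_def
      by (subst (1 2) card_common_translates) (use V in simp_all)
    finally show ?thesis
      by (auto simp: truncated_prod_def of_nat_diff)
  qed
  have "cluster_sum M j = (\<lambda>n. \<Sum>y\<in>Y. cluster_weight M 0 V y * truncated_prod [a y, b y] n)"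
  proof
    fix n
    have "cluster_sum M j n = (\<Sum>x\<in>V \<rightarrow>\<^sub>E board n. cluster_weight M 0 V x)"
      using sum_cluster_weight[OF V(1,2), of M n] V(4) by simp
    also have "\<dots> = (\<Sum>x\<in>{x \<in> V \<rightarrow>\<^sub>E board n. shape x \<in> Y}. cluster_weight M 0 V x)"
    proof (rule sum.mono_neutral_right[OF finX])
      show "\<forall>x\<in>(V \<rightarrow>\<^sub>E board n) - {x \<in> V \<rightarrow>\<^sub>E board n. shape x \<in> Y}. cluster_weight M 0 V x = 0"
      proof (rule ballI, rule ccontr)
        fix x assume x: "x \<in> (V \<rightarrow>\<^sub>E board n) - {x \<in> V \<rightarrow>\<^sub>E board n. shape x \<in> Y}"
          and nz: "cluster_weight M 0 V x \<noteq> 0"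
        have close: "fst (x k - x i) \<le> int D" "snd (x k - x i) \<le> int D" if "i \<in> V" "k \<in> V" for i k
        proof -
          have card: "card V - 1 = j" using V(4) by simp
          show "fst (x k - x i) \<le> int D"
          proof (rule ccontr)
            assume far: "\<not> ?thesis"
            have "cluster_weight M 0 V x = 0"
              by (rule cluster_weight_eq_0[of fst M "max_coord M", OF fst_diff
                    max_coord_ge(1)[OF assms] V(1,2) that])
                (use far in \<open>simp_all only: card D_def not_le\<close>)
            with nz show False by blast
          qed
          show "snd (x k - x i) \<le> int D"
          proof (rule ccontr)
            assume far: "\<not> ?thesis"
            have "cluster_weight M 0 V x = 0"
              by (rule cluster_weight_eq_0[of snd M "max_coord M", OF snd_diff
                    max_coord_ge(2)[OF assms] V(1,2) that])
                (use far in \<open>simp_all only: card D_def not_le\<close>)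
            with nz show False by blast
          qed
        qed
        have "shape x \<in> Y"
          unfolding Y_def
        proof (intro CollectI conjI ballI)
          show "shape x \<in> V \<rightarrow>\<^sub>E {-int D..int D} \<times> {-int D..int D}"
          proof (rule PiE_I)
            fix i assume i: "i \<in> V"
            show "shape x i \<in> {-int D..int D} \<times> {-int D..int D}"
              using close[OF i V(2)] close[OF V(2) i] i by (auto simp: shape_def mem_Times_iff)
          qed (simp add: shape_def)
          show "shape x 0 = 0" using V(2) by (simp add: shape_def)
        qed (use close in \<open>auto simp: shape_def\<close>)
        then show False using x by blast
      qed
    qed auto
    also have "\<dots> = (\<Sum>y\<in>Y. \<Sum>x\<in>{x \<in> {x \<in> V \<rightarrow>\<^sub>E board n. shape x \<in> Y}. shape x = y}.
        cluster_weight M 0 V x)"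
      by (rule sum.group[symmetric]) (use finX finY in auto)
    also have "\<dots> = (\<Sum>y\<in>Y. cluster_weight M 0 V y * truncated_prod [a y, b y] n)"
    proof (rule sum.cong)
      fix y assume y: "y \<in> Y"
      have "(\<Sum>x\<in>{x \<in> {x \<in> V \<rightarrow>\<^sub>E board n. shape x \<in> Y}. shape x = y}. cluster_weight M 0 V x) =
          (\<Sum>x\<in>{x \<in> V \<rightarrow>\<^sub>E board n. shape x = y}. cluster_weight M 0 V y)"
      proof (rule sum.cong)
        fix x assume x: "x \<in> {x \<in> V \<rightarrow>\<^sub>E board n. shape x = y}"
        show "cluster_weight M 0 V x = cluster_weight M 0 V y"
        proof (rule cluster_weight_cong)
          fix i k assume "i \<in> V" "k \<in> V"
          moreover have "y = shape x" using x by blast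
          ultimately show "x k - x i = y k - y i" by (simp add: shape_def)
        qed
      qed (use y in auto)
      then show "(\<Sum>x\<in>{x \<in> {x \<in> V \<rightarrow>\<^sub>E board n. shape x \<in> Y}. shape x = y}. cluster_weight M 0 V x) =
          cluster_weight M 0 V y * truncated_prod [a y, b y] n"
        using fibre[OF y, of n] by simp
    qed simp
    finally show "cluster_sum M j n =
      (\<Sum>y\<in>Y. cluster_weight M 0 V y * truncated_prod [a y, b y] n)" .
  qed
  moreover have "truncated_comb D 1 (\<lambda>n. \<Sum>y\<in>Y. cluster_weight M 0 V y * truncated_prod [a y, b y] n)"
    by (intro truncated_comb_sum truncated_comb_generator) (use span in auto)
  ultimately show ?thesis
    unfolding D_def by (simp only:)
qed

section \<open>The exponential formula\<close>

text \<open>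
  With exponential generating functions \<open>z\<close>, \<open>g\<close>, \<open>u\<close> of \<open>Z\<close>, \<open>G\<close>, \<open>U\<close>, the hypotheses read \<open>z' = u z\<close> and
  \<open>g' = (u - U 0) g\<close>, with \<open>z(0) = g(0) = 1\<close>.  Hence \<open>z(t) = exp (U 0 * t) * g(t)\<close>, which is the claim.
  The proof checks that the right-hand side satisfies the recursion for \<open>Z\<close>: by Pascal's rule, its
  value at \<open>p + 1\<close> is \<open>U 0\<close> times its value at \<open>p\<close>, the term \<open>j = 0\<close>, plus a sum with \<open>G (k + 1)\<close>, which
  the recursion for \<open>G\<close> turns into the other terms.
\<close>

lemma exponential_formula:
  fixes U G Z :: "nat \<Rightarrow> 'b::comm_semiring_1"
  assumes Z: "Z 0 = 1" "\<And>q. Z (Suc q) = (\<Sum>j\<le>q. of_nat (q choose j) * (U j * Z (q - j)))"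
    and G: "G 0 = 1" "\<And>k. G (Suc k) = (\<Sum>j=1..k. of_nat (k choose j) * (U j * G (k - j)))"
  shows "Z q = (\<Sum>k\<le>q. of_nat (q choose k) * (U 0 ^ (q - k) * G k))"
proof (induction q rule: less_induct)
  case (less q)
  define F where "F q = (\<Sum>k\<le>q. of_nat (q choose k) * (U 0 ^ (q - k) * G k))" for q
  have ih: "Z p = F p" if "p < q" for p
    using less that unfolding F_def by blast
  have "Z q = F q"
  proof (cases q)
    case 0
    then show ?thesis by (simp add: F_def Z G)
  next
    case (Suc p)
    let ?H = "\<Sum>k\<le>p. of_nat (p choose k) * (U 0 ^ (p - k) * G (Suc k))"
    have "?H = (\<Sum>k\<le>p. \<Sum>j=1..k. of_nat (p choose k) * of_nat (k choose j) *
        (U 0 ^ (p - k) * (U j * G (k - j))))"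
      by (simp add: G sum_distrib_left mult_ac)
    also have "\<dots> = (\<Sum>(k, j)\<in>(SIGMA k:{..p}. {1..k}). of_nat (p choose k) * of_nat (k choose j) *
        (U 0 ^ (p - k) * (U j * G (k - j))))"
      by (rule sum.Sigma) auto
    also have "\<dots> = (\<Sum>(j, l)\<in>(SIGMA j:{1..p}. {..p - j}). of_nat (p choose j) * of_nat ((p - j) choose l) *
        (U 0 ^ (p - j - l) * (U j * G l)))"
    proof (rule sum.reindex_bij_witness[where i = "\<lambda>(j, l). (j + l, j)" and j = "\<lambda>(k, j). (j, k - j)"])
      fix kj assume "kj \<in> (SIGMA k:{..p}. {1..k})"
      then obtain k j where kj: "kj = (k, j)" "k \<le> p" "1 \<le> j" "j \<le> k" by auto
      have "of_nat (p choose k) * of_nat (k choose j) =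
          (of_nat (p choose j) * of_nat ((p - j) choose (k - j)) :: 'b)"
        using choose_mult[OF kj(4,2)] by (metis of_nat_mult)
      then show "(\<lambda>(j, l). of_nat (p choose j) * of_nat ((p - j) choose l) *
          (U 0 ^ (p - j - l) * (U j * G l))) ((\<lambda>(k, j). (j, k - j)) kj) =
          (\<lambda>(k, j). of_nat (p choose k) * of_nat (k choose j) * (U 0 ^ (p - k) * (U j * G (k - j)))) kj"
        using kj by simp
    qed auto
    also have "\<dots> = (\<Sum>j=1..p. \<Sum>l\<le>p - j. of_nat (p choose j) * of_nat ((p - j) choose l) *
        (U 0 ^ (p - j - l) * (U j * G l)))"
      by (rule sum.Sigma[symmetric]) auto
    also have "\<dots> = (\<Sum>j=1..p. of_nat (p choose j) * (U j * F (p - j)))"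
      by (simp add: F_def sum_distrib_left mult_ac)
    finally have H: "?H = (\<Sum>j=1..p. of_nat (p choose j) * (U j * F (p - j)))" .
    have "U 0 * F p = (\<Sum>k\<le>p. of_nat (p choose k) * (U 0 ^ (Suc p - k) * G k))"
      unfolding F_def sum_distrib_left by (intro sum.cong) (auto simp: Suc_diff_le mult_ac)
    also have "\<dots> = (\<Sum>k\<le>Suc p. of_nat (p choose k) * (U 0 ^ (Suc p - k) * G k))"
      by (simp add: binomial_eq_0)
    also have "\<dots> = U 0 ^ Suc p * G 0 + (\<Sum>k\<le>p. of_nat (p choose Suc k) * (U 0 ^ (p - k) * G (Suc k)))"
      by (subst sum.atMost_Suc_shift) simp
    finally have U: "U 0 * F p =
      U 0 ^ Suc p * G 0 + (\<Sum>k\<le>p. of_nat (p choose Suc k) * (U 0 ^ (p - k) * G (Suc k)))" .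
    have "F (Suc p) = U 0 ^ Suc p * G 0 +
        (\<Sum>k\<le>p. of_nat (Suc p choose Suc k) * (U 0 ^ (p - k) * G (Suc k)))"
      unfolding F_def by (subst sum.atMost_Suc_shift) simp
    also have "\<dots> = U 0 * F p + ?H"
      unfolding U by (simp add: algebra_simps sum.distrib)
    also have "\<dots> = of_nat (p choose 0) * (U 0 * F (p - 0)) +
        (\<Sum>j=1..p. of_nat (p choose j) * (U j * F (p - j)))"
      unfolding H by simp
    also have "\<dots> = (\<Sum>j\<le>p. of_nat (p choose j) * (U j * F (p - j)))"
    proof -
      have "{..p} = insert 0 {1..p}" by auto
      then show ?thesis by simp
    qed
    also have "\<dots> = Z (Suc p)"
      unfolding Z using Suc ih by (intro sum.cong refl) simp
    finally show ?thesis using Suc by simp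
  qed
  then show ?case unfolding F_def .
qed

text \<open>
  The sum, over all partitions of \<open>k\<close> pieces into \<open>c\<close> clusters of at least two pieces each, of the
  product of their cluster sums: the cluster of the first piece has \<open>j \<ge> 1\<close> other members, and
  \<open>k - j\<close> pieces are left.
\<close>

fun cover_sum :: "(int \<times> int) set \<Rightarrow> nat \<Rightarrow> nat \<Rightarrow> nat \<Rightarrow> rat" where
  "cover_sum M 0 k n = of_bool (k = 0)"
| "cover_sum M (Suc c) 0 n = 0"
| "cover_sum M (Suc c) (Suc k) n =
     (\<Sum>j=1..k. of_nat (k choose j) * (cluster_sum M j n * cover_sum M c (k - j) n))"

lemma cover_sum_eq_0: "k < 2 * c \<Longrightarrow> cover_sum M c k n = 0"
proof (induction c arbitrary: k)
  case (Suc c)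
  show ?case
  proof (cases k)
    case (Suc k')
    have "cover_sum M c (k' - j) n = 0" if "j \<in> {1..k'}" for j
      by (rule Suc.IH) (use that Suc Suc.prems in auto)
    then show ?thesis using Suc by simp
  qed simp
qed simp

text \<open>
  A cluster of \<open>j + 1\<close> pieces contributes \<open>j\<close> to \<open>k - c\<close>, and its entries are at most
  \<open>max_coord M * j\<close>; so the entries of a product of cluster sums are at most \<open>max_coord M * (k - c)\<close>.
\<close>

lemma cover_sum_truncated_comb:
  assumes "finite M"
  shows "truncated_comb (max_coord M * (k - c)) c (cover_sum M c k)"
proof (induction c arbitrary: k)
  case 0
  have "truncated_comb (max_coord M * k) 0 (\<lambda>n. of_bool (k = 0) * truncated_prod [] n)"
    by (rule truncated_comb_generator) auto
  moreover have "cover_sum M 0 k = (\<lambda>n. of_bool (k = 0) * truncated_prod [] n)"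
    by (auto simp: fun_eq_iff truncated_prod_def)
  ultimately show ?case by simp
next
  case (Suc c)
  let ?b = "max_coord M * (k - Suc c)"
  show ?case
  proof (cases k)
    case 0
    have "cover_sum M (Suc c) 0 = (\<lambda>n. 0)" by (rule ext) simp
    then show ?thesis using 0 truncated_comb.zero by simp
  next
    case k: (Suc k')
    have "truncated_comb ?b (Suc c)
        (\<lambda>n. of_nat (k' choose j) * (cluster_sum M j n * cover_sum M c (k' - j) n))"
      if j: "j \<in> {1..k'}" for j
    (* If too few pieces remain, truncated subtraction would spoil the bound, but the term vanishes. *)
    proof (cases "k' - j < 2 * c")
      case True
      then show ?thesis
        using truncated_comb.zero by (simp add: cover_sum_eq_0)
    next
      case False
      then have le: "j \<le> k - Suc c" "k' - j - c \<le> k - Suc c" using j k by auto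
      have "truncated_comb ?b 1 (cluster_sum M j)"
        by (rule truncated_comb_mono[OF cluster_sum_truncated_comb[OF assms] mult_le_mono2[OF le(1)]])
      moreover have "truncated_comb ?b c (cover_sum M c (k' - j))"
        by (rule truncated_comb_mono[OF Suc.IH mult_le_mono2[OF le(2)]])
      ultimately have "truncated_comb ?b (1 + c)
          (\<lambda>n. cluster_sum M j n * cover_sum M c (k' - j) n)"
        by (rule truncated_comb_mult)
      from truncated_comb_cmult[OF this] show ?thesis by simp
    qed
    then have "truncated_comb ?b (Suc c)
        (\<lambda>n. \<Sum>j=1..k'. of_nat (k' choose j) * (cluster_sum M j n * cover_sum M c (k' - j) n))"
      by (rule truncated_comb_sum)
    moreover have "cover_sum M (Suc c) k =
        (\<lambda>n. \<Sum>j=1..k'. of_nat (k' choose j) * (cluster_sum M j n * cover_sum M c (k' - j) n))"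
      by (rule ext) (simp add: k)
    ultimately show ?thesis by (simp only:)
  qed
qed

lemma cluster_sum_0: "cluster_sum M 0 n = of_nat n ^ 2"
proof -
  have "placement_count M 1 n = (\<Sum>x\<in>{0::nat} \<rightarrow>\<^sub>E board n. of_bool (attack_free M x {0}))"
    by (rule placement_count_eq_sum[symmetric]) simp_all
  also have "\<dots> = of_nat (card ({0::nat} \<rightarrow>\<^sub>E board n))"
    by (simp add: attack_free_def)
  also have "\<dots> = of_nat n ^ 2"
    by (simp add: card_PiE card_cartesian_product power2_eq_square)
  finally show ?thesis
    using cluster_sum.simps[of M 0 n] by simp
qed

lemma placement_count_cover_expansion:
  "placement_count M q n =
     (\<Sum>k\<le>q. of_nat (q choose k) * (of_nat n ^ (2 * (q - k)) * (\<Sum>c\<le>k. cover_sum M c k n)))"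
proof -
  define G where "G k = (\<Sum>c\<le>k. cover_sum M c k n)" for k
  have "placement_count M q n =
      (\<Sum>k\<le>q. of_nat (q choose k) * (cluster_sum M 0 n ^ (q - k) * G k))"
  proof (rule exponential_formula[where U = "\<lambda>j. cluster_sum M j n"])
    show "placement_count M (Suc q) n =
        (\<Sum>j\<le>q. of_nat (q choose j) * (cluster_sum M j n * placement_count M (q - j) n))" for q
      by (rule placement_count_Suc)
    show "G (Suc k) = (\<Sum>j=1..k. of_nat (k choose j) * (cluster_sum M j n * G (k - j)))" for k
    proof -
      have "G (Suc k) = (\<Sum>c\<le>k. cover_sum M (Suc c) (Suc k) n)"
        unfolding G_def by (subst sum.atMost_Suc_shift) simp
      also have "\<dots> = (\<Sum>j=1..k. \<Sum>c\<le>k.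
          of_nat (k choose j) * (cluster_sum M j n * cover_sum M c (k - j) n))"
        by (subst sum.swap) simp
      also have "\<dots> = (\<Sum>j=1..k. of_nat (k choose j) * (cluster_sum M j n * G (k - j)))"
      proof (rule sum.cong)
        fix j
        have "(\<Sum>c\<le>k. cover_sum M c (k - j) n) = G (k - j)"
          unfolding G_def by (rule sum.mono_neutral_right) (auto intro: cover_sum_eq_0)
        then show "(\<Sum>c\<le>k. of_nat (k choose j) * (cluster_sum M j n * cover_sum M c (k - j) n)) =
            of_nat (k choose j) * (cluster_sum M j n * G (k - j))"
          by (simp flip: sum_distrib_left)
      qed simp
      finally show ?thesis .
    qed
  qed (simp_all add: G_def)
  then show ?thesis
    by (simp add: G_def cluster_sum_0 power_mult)
qed

text \<open>
  The part of codegree \<open>2 * s\<close> of the expansion: \<open>c\<close> clusters with \<open>k = c + s\<close> pieces in total.  There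
  are at most \<open>s\<close> clusters because each of them has at least two members.
\<close>

definition codegree_part :: "(int \<times> int) set \<Rightarrow> nat \<Rightarrow> nat \<Rightarrow> nat \<Rightarrow> rat" where
  "codegree_part M s q n =
     (\<Sum>c\<le>s. of_nat (q choose (c + s)) * (of_nat n ^ (2 * (q - (c + s))) * cover_sum M c (c + s) n))"

lemma placement_count_codegree_expansion:
  "placement_count M q n = of_nat n ^ (2 * q) + (\<Sum>s=1..q. codegree_part M s q n)"
proof -
  define t where
    "t k c = of_nat (q choose k) * (of_nat n ^ (2 * (q - k)) * cover_sum M c k n)" for k c
  have zero: "t k c = 0" if "k < 2 * c \<or> q < k" for k c
    using that by (auto simp: t_def cover_sum_eq_0)
  have "placement_count M q n = (\<Sum>k\<le>q. \<Sum>c\<le>k. t k c)"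
    by (simp add: placement_count_cover_expansion t_def sum_distrib_left)
  also have "\<dots> = (\<Sum>(k, c)\<in>(SIGMA k:{..q}. {..k}). t k c)"
    by (rule sum.Sigma) auto
  also have "\<dots> = (\<Sum>(s, c)\<in>(SIGMA s:{..q}. {..s}). t (c + s) c)"
    (* The substitution s = k - c.  The two index sets do not match where k < 2 * c, i.e. s < c,
       and where q < k; there the terms vanish. *)
    by (rule sum.reindex_bij_witness_not_neutral[where
          S' = "{(k, c). c \<le> k \<and> k \<le> q \<and> k < 2 * c}" and T' = "{(s, c). c \<le> s \<and> s \<le> q \<and> q < c + s}"
          and j = "\<lambda>(k, c). (k - c, c)" and i = "\<lambda>(s, c). (c + s, c)"])
      (auto simp: zero intro: finite_subset[of _ "{..q} \<times> {..q}"])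
  also have "\<dots> = (\<Sum>s\<le>q. \<Sum>c\<le>s. t (c + s) c)"
    by (rule sum.Sigma[symmetric]) auto
  also have "\<dots> = (\<Sum>s\<le>q. codegree_part M s q n)"
    by (simp add: codegree_part_def t_def)
  also have "{..q} = insert 0 {1..q}" by auto
  also have "(\<Sum>s\<in>insert 0 {1..q}. codegree_part M s q n) =
      codegree_part M 0 q n + (\<Sum>s=1..q. codegree_part M s q n)"
    by simp
  also have "codegree_part M 0 q n = of_nat n ^ (2 * q)"
    by (simp add: codegree_part_def)
  finally show ?thesis .
qed

section \<open>Explicit terms\<close>

lemma falling_eq_binomial: "falling q k = fact k * of_nat (q choose k)"
proof -
  have "falling q k = (\<Prod>i=0..<k. of_nat q - of_nat i)"
    by (simp add: falling_def atLeast0LessThan)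
  also have "\<dots> = fact k * (of_nat q gchoose k)"
    by (simp add: gbinomial_prod_rev)
  finally show ?thesis
    by (simp add: binomial_gbinomial)
qed

lemma falling_eq_0_iff: "falling q k = 0 \<longleftrightarrow> q < k"
  by (simp add: falling_eq_binomial)

type_synonym cover_term = "nat \<times> nat \<times> rat \<times> nat list"

definition term_value :: "cover_term \<Rightarrow> nat \<Rightarrow> nat \<Rightarrow> rat" where
  "term_value = (\<lambda>(k, c, C, as) q n.
     falling q k / C * of_nat n ^ (2 * (q - k)) * truncated_prod as n)"

definition valid_term :: "nat \<Rightarrow> nat \<Rightarrow> cover_term \<Rightarrow> bool" where
  "valid_term b s = (\<lambda>(k, c, C, as).
     k = c + s \<and> C \<noteq> 0 \<and> length as = 2 * c \<and> (\<forall>a\<in>set as. a \<le> b))"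

text \<open>
  A coefficient \<open>\<sigma>\<close> of \<open>cover_sum\<close> becomes \<open>C = fact k / \<sigma>\<close>, as \<open>q choose k = falling q k / fact k\<close>.
\<close>

lemma codegree_part_terms:
  assumes "finite M"
  shows "\<exists>L. (\<forall>t\<in>set L. valid_term (max_coord M * s) s t) \<and>
    (\<forall>q n. codegree_part M s q n = (\<Sum>t\<leftarrow>L. term_value t q n))"
proof -
  have "\<forall>c. \<exists>L. (\<forall>(\<sigma>, as)\<in>set L. \<sigma> \<noteq> 0 \<and> length as = 2 * c \<and> (\<forall>a\<in>set as. a \<le> max_coord M * s)) \<and>
      (\<forall>n. cover_sum M c (c + s) n = (\<Sum>(\<sigma>, as)\<leftarrow>L. \<sigma> * truncated_prod as n))"
  proof
    fix c
    have "truncated_comb (max_coord M * s) c (cover_sum M c (c + s))"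
      using cover_sum_truncated_comb[OF assms, of "c + s" c] by simp
    then show "\<exists>L. (\<forall>(\<sigma>, as)\<in>set L. \<sigma> \<noteq> 0 \<and> length as = 2 * c \<and> (\<forall>a\<in>set as. a \<le> max_coord M * s)) \<and>
      (\<forall>n. cover_sum M c (c + s) n = (\<Sum>(\<sigma>, as)\<leftarrow>L. \<sigma> * truncated_prod as n))"
      by (rule truncated_comb_imp_list)
  qed
  then obtain L where L: "\<forall>c. (\<forall>(\<sigma>, as)\<in>set (L c).
        \<sigma> \<noteq> 0 \<and> length as = 2 * c \<and> (\<forall>a\<in>set as. a \<le> max_coord M * s)) \<and>
      (\<forall>n. cover_sum M c (c + s) n = (\<Sum>(\<sigma>, as)\<leftarrow>L c. \<sigma> * truncated_prod as n))"
    using choice[of "\<lambda>c L. (\<forall>(\<sigma>, as)\<in>set L.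
        \<sigma> \<noteq> 0 \<and> length as = 2 * c \<and> (\<forall>a\<in>set as. a \<le> max_coord M * s)) \<and>
      (\<forall>n. cover_sum M c (c + s) n = (\<Sum>(\<sigma>, as)\<leftarrow>L. \<sigma> * truncated_prod as n))"] by blast
  have cover: "cover_sum M c (c + s) n = (\<Sum>(\<sigma>, as)\<leftarrow>L c. \<sigma> * truncated_prod as n)" for c n
    using L by blast
  define T where "T c = map (\<lambda>(\<sigma>, as). (c + s, c, fact (c + s) / \<sigma>, as)) (L c)" for c
  have valid: "valid_term (max_coord M * s) s t" if mem: "t \<in> set (T c)" for c t
  proof -
    obtain \<sigma> as where t: "(\<sigma>, as) \<in> set (L c)" "t = (c + s, c, fact (c + s) / \<sigma>, as)"
      using mem unfolding T_def by auto
    then have "\<sigma> \<noteq> 0 \<and> length as = 2 * c \<and> (\<forall>a\<in>set as. a \<le> max_coord M * s)"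
      using L by blast
    then show ?thesis by (simp add: valid_term_def t(2))
  qed
  have T: "(\<Sum>t\<leftarrow>T c. term_value t q n) =
      of_nat (q choose (c + s)) * (of_nat n ^ (2 * (q - (c + s))) * cover_sum M c (c + s) n)" for c q n
    unfolding cover T_def sum_list_const_mult[symmetric] map_map
    by (intro arg_cong[where f = sum_list] map_cong refl)
      (auto simp: term_value_def falling_eq_binomial)
  have concat: "(\<Sum>t\<leftarrow>concat (map T cs). term_value t q n) = (\<Sum>c\<leftarrow>cs. \<Sum>t\<leftarrow>T c. term_value t q n)"
    for cs q n
    by (induction cs) auto
  have "codegree_part M s q n = (\<Sum>t\<leftarrow>concat (map T [0..<Suc s]). term_value t q n)" for q n
  proof -
    have "(\<Sum>t\<leftarrow>concat (map T [0..<Suc s]). term_value t q n) =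
        (\<Sum>c\<leftarrow>[0..<Suc s]. \<Sum>t\<leftarrow>T c. term_value t q n)"
      by (rule concat)
    also have "\<dots> = (\<Sum>c\<le>s. \<Sum>t\<leftarrow>T c. term_value t q n)"
      by (simp only: interv_sum_list_conv_sum_set_nat set_upt atLeast0LessThan lessThan_Suc_atMost)
    finally show ?thesis
      by (simp only: T codegree_part_def)
  qed
  moreover have "\<forall>t\<in>set (concat (map T [0..<Suc s])). valid_term (max_coord M * s) s t"
    using valid by auto
  ultimately show ?thesis by blast
qed

section \<open>Two-level polynomials\<close>

lemma codegree_coeff_shift:
  assumes "degree p \<le> d"
  shows "codegree_coeff (d + e) p i = (if i < e then 0 else codegree_coeff d p (i - e))"
  using assms by (auto simp: codegree_coeff_def coeff_eq_0)

lemma codegree_coeff_smult: "codegree_coeff d (smult a p) i = a * codegree_coeff d p i"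
  by (simp add: codegree_coeff_def)

lemma codegree_coeff_sum_list:
  "codegree_coeff d (\<Sum>t\<leftarrow>L. f t) i = (\<Sum>t\<leftarrow>L. codegree_coeff d (f t) i)"
  by (induction L) (auto simp: codegree_coeff_def)

lemma codegree_coeff_sum:
  "codegree_coeff d (\<Sum>t\<in>S. f t) i = (\<Sum>t\<in>S. codegree_coeff d (f t) i)"
  by (auto simp: codegree_coeff_def coeff_sum)

lemma poly_sum_list: "poly (\<Sum>t\<leftarrow>L. f t) x = (\<Sum>t\<leftarrow>L. poly (f t) x)"
  by (induction L) auto

definition root_poly :: "nat list \<Rightarrow> rat poly" where
  "root_poly as = (\<Prod>a\<leftarrow>as. [:- of_nat a, 1:])"

lemma degree_root_poly: "degree (root_poly as) \<le> length as"
proof (induction as)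
  case (Cons a as)
  have "degree (root_poly (a # as)) \<le> degree [:- of_nat a :: rat, 1:] + degree (root_poly as)"
    unfolding root_poly_def list.map prod_list.Cons by (rule degree_mult_le)
  then show ?case using Cons by simp
qed (simp add: root_poly_def)

lemma poly_root_poly:
  assumes "\<forall>a\<in>set as. a \<le> n"
  shows "poly (root_poly as) (of_nat n) = truncated_prod as n"
proof -
  have "poly (root_poly as) (of_nat n) = (\<Prod>a\<leftarrow>as. of_nat n - of_nat a)"
    by (induction as) (simp_all add: root_poly_def algebra_simps)
  then show ?thesis using assms by (simp add: truncated_prod_def)
qed

definition term_poly :: "cover_term \<Rightarrow> nat \<Rightarrow> rat poly" where
  "term_poly = (\<lambda>(k, c, C, as) q.
     smult (falling q k / C) (monom 1 (2 * (q - k)) * root_poly as))"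

lemma poly_term_poly:
  assumes "valid_term b s t" "b \<le> n"
  shows "poly (term_poly t q) (of_nat n) = term_value t q n"
proof -
  obtain k c C as where t: "t = (k, c, C, as)" by (cases t)
  have "\<forall>a\<in>set as. a \<le> n"
    using assms unfolding t valid_term_def by force
  from poly_root_poly[OF this] show ?thesis
    by (simp add: t term_poly_def term_value_def poly_monom)
qed

lemma term_poly_eq_0:
  assumes "valid_term b s t" "q < s"
  shows "term_poly t q = 0"
  using assms by (auto simp: valid_term_def term_poly_def falling_eq_0_iff)

lemma degree_term_poly:
  assumes "valid_term b s t" "s \<le> q"
  shows "degree (term_poly t q) \<le> 2 * q - 2 * s"
proof -
  obtain k c C as where t: "t = (k, c, C, as)" by (cases t)
  have k: "k = c + s" "length as = 2 * c"
    using assms(1) by (auto simp: t valid_term_def)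
  show ?thesis
  proof (cases "k \<le> q")
    case True
    have "degree (term_poly t q) \<le> degree (monom 1 (2 * (q - k)) * root_poly as)"
      unfolding t term_poly_def prod.case by (rule degree_smult_le)
    also have "\<dots> \<le> 2 * (q - k) + 2 * c"
      using degree_mult_le[of "monom 1 (2 * (q - k)) :: rat poly" "root_poly as"]
        degree_root_poly[of as] degree_monom_le[of "1::rat" "2 * (q - k)"] k by linarith
    finally show ?thesis using k True by simp
  qed (simp add: t term_poly_def falling_eq_0_iff)
qed

text \<open>
  The codegree coefficients of a term, as polynomials in \<open>q\<close>: the falling factorial is the polynomial
  with roots \<open>0, \<dots>, k - 1\<close>.
\<close>

definition term_coeff :: "nat \<Rightarrow> cover_term \<Rightarrow> rat poly" where
  "term_coeff i = (\<lambda>(k, c, C, as).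
     smult (codegree_coeff (2 * c) (root_poly as) i / C) (root_poly [0..<k]))"

lemma poly_falling: "poly (root_poly [0..<k]) (of_nat q) = falling q k"
  by (induction k) (simp_all add: root_poly_def falling_def algebra_simps)

text \<open>
  The power \<open>n ^ (2 * (q - k))\<close> shifts all exponents, so the codegree coefficients are those of
  \<open>root_poly as\<close>, up to the scalar factor.  For \<open>q < k\<close> both sides vanish, even where \<open>q < s\<close>.
\<close>

lemma codegree_coeff_term_poly:
  assumes "valid_term b s t"
  shows "codegree_coeff (2 * q - 2 * s) (term_poly t q) i = poly (term_coeff i t) (of_nat q)"
proof -
  obtain k c C as where t: "t = (k, c, C, as)" by (cases t)
  have k: "k = c + s"
    using assms by (auto simp: t valid_term_def)
  show ?thesis
  proof (cases "k \<le> q")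
    case True
    then have eq: "2 * q - 2 * s = 2 * (q - k) + 2 * c" using k by simp
    have "codegree_coeff (2 * (q - k) + 2 * c) (monom 1 (2 * (q - k)) * root_poly as) i =
        codegree_coeff (2 * c) (root_poly as) i"
    proof (cases "i \<le> 2 * c")
      case True
      then have "2 * (q - k) + 2 * c - i = (2 * c - i) + 2 * (q - k)" by simp
      then show ?thesis
        using True by (simp add: codegree_coeff_def coeff_monom_mult not_less)
    qed (auto simp: codegree_coeff_def coeff_monom_mult)
    then show ?thesis
      by (simp add: t term_poly_def term_coeff_def poly_falling eq codegree_coeff_smult)
  next
    case False
    then have "falling q k = 0" by (simp add: falling_eq_0_iff)
    then show ?thesis
      by (simp add: t term_poly_def term_coeff_def poly_falling codegree_coeff_def)
  qed
qed

lemma linear_index_set: "index_set [:- of_nat r, 2:] = {q. r \<le> 2 * q}"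
proof -
  have "0 \<le> poly [:- of_nat r, 2:] (of_nat q :: rat) \<longleftrightarrow> (of_nat r :: rat) \<le> of_nat (2 * q)" for q
    by (simp add: mult.commute)
  then show ?thesis unfolding index_set_def by (simp only: of_nat_le_iff)
qed

lemma linear_degree_at: "degree_at [:- of_nat r, 2:] q = 2 * q - r"
proof -
  have "poly [:- of_nat r, 2:] (of_nat q :: rat) = of_int (2 * int q - int r)"
    by (simp add: mult.commute)
  then have "\<lfloor>poly [:- of_nat r, 2:] (of_nat q :: rat)\<rfloor> = 2 * int q - int r"
    by (simp only: floor_of_int)
  then show ?thesis unfolding degree_at_def by linarith
qed

lemma linear_degree_function: "degree_function [:- of_nat r, 2:]"
proof -
  have "poly [:- of_nat r, 2:] (of_int q :: rat) \<in> \<int>" for q :: int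
    by simp
  moreover have "\<forall>\<^sub>F q in sequentially. 0 \<le> poly [:- of_nat r, 2:] (of_nat q :: rat)"
  proof (rule eventually_sequentiallyI)
    fix q :: nat assume "r \<le> q"
    then have "q \<in> index_set [:- of_nat r, 2:]" by (simp only: linear_index_set mem_Collect_eq)
    then show "0 \<le> poly [:- of_nat r, 2:] (of_nat q :: rat)" by (simp add: index_set_def)
  qed
  ultimately show ?thesis by (simp add: degree_function_def numerical_poly_def)
qed

lemma infinite_depth_depth_function: "depth_function g (infinite_depth g)"
  by (simp add: depth_function_def infinite_depth_def)

text \<open>
  The lists of terms are not canonical, so one choice is fixed throughout: the data of the expansion
  and the polynomials that it yields have to be built from the same lists.
\<close>

locale codegree_terms =
  fixes M :: "(int \<times> int) set" and L :: "nat \<Rightarrow> cover_term list"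
  assumes valid: "\<And>s t. t \<in> set (L s) \<Longrightarrow> valid_term (max_coord M * s) s t"
    and part: "\<And>s q n. codegree_part M s q n = (\<Sum>t\<leftarrow>L s. term_value t q n)"
begin

definition part_poly :: "nat \<Rightarrow> nat \<Rightarrow> rat poly" where
  "part_poly s q = (\<Sum>t\<leftarrow>L s. term_poly t q)"

definition part_coeff :: "nat \<Rightarrow> nat \<Rightarrow> rat poly" where
  "part_coeff s i = (\<Sum>t\<leftarrow>L s. term_coeff i t)"

lemma poly_part_poly:
  assumes "max_coord M * s \<le> n"
  shows "poly (part_poly s q) (of_nat n) = codegree_part M s q n"
  unfolding part_poly_def poly_sum_list part
  by (intro arg_cong[where f = sum_list] map_cong refl poly_term_poly[OF valid assms])

lemma part_poly_eq_0:
  assumes "q < s"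
  shows "part_poly s q = 0"
proof -
  have "map (\<lambda>t. term_poly t q) (L s) = map (\<lambda>t. 0) (L s)"
    by (intro map_cong refl term_poly_eq_0[OF valid assms])
  then have "part_poly s q = (\<Sum>t\<leftarrow>L s. 0)" unfolding part_poly_def by (simp only:)
  then show ?thesis by simp
qed

lemma degree_part_poly:
  assumes "s \<le> q"
  shows "degree (part_poly s q) \<le> 2 * q - 2 * s"
  unfolding part_poly_def using degree_term_poly[OF valid assms]
  by (intro degree_sum_list_le) auto

lemma codegree_coeff_part_poly:
  "codegree_coeff (2 * q - 2 * s) (part_poly s q) i = poly (part_coeff s i) (of_nat q)"
  unfolding part_poly_def part_coeff_def codegree_coeff_sum_list poly_sum_list
  by (intro arg_cong[where f = sum_list] map_cong refl codegree_coeff_term_poly[OF valid])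

lemma two_level_part_poly:
  "two_level_polynomial [:- of_nat (2 * s), 2:] (infinite_depth [:- of_nat (2 * s), 2:])
     (part_poly s)"
  unfolding two_level_polynomial_def polynomial_codegree_coeffs_def linear_index_set linear_degree_at
proof (intro conjI)
  show "\<exists>\<phi>. \<forall>q\<in>{q. 2 * s \<le> 2 * q}. \<forall>r. Fin (int r) \<le> infinite_depth [:- of_nat (2 * s), 2:] q \<longrightarrow>
      codegree_coeff (2 * q - 2 * s) (part_poly s q) r = poly (\<phi> r) (of_nat q)"
    using codegree_coeff_part_poly by blast
  show "\<forall>q\<in>{q. 2 * s \<le> 2 * q}. degree (part_poly s q) \<le> 2 * q - 2 * s"
    by (simp add: degree_part_poly)
  show "\<forall>q. q \<notin> {q. 2 * s \<le> 2 * q} \<longrightarrow> part_poly s q = 0"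
    by (simp add: part_poly_eq_0)
qed (rule linear_degree_function infinite_depth_depth_function)+

definition count_poly :: "nat \<Rightarrow> rat poly" where
  "count_poly q = monom 1 (2 * q) + (\<Sum>s=1..q. part_poly s q)"

lemma poly_count_poly:
  assumes "max_coord M * q \<le> n"
  shows "poly (count_poly q) (of_nat n) = placement_count M q n"
proof -
  have "poly (part_poly s q) (of_nat n) = codegree_part M s q n" if "s \<in> {1..q}" for s
  proof (rule poly_part_poly)
    have "max_coord M * s \<le> max_coord M * q" using that by simp
    then show "max_coord M * s \<le> n" using assms by linarith
  qed
  then show ?thesis
    by (simp add: count_poly_def poly_monom poly_sum placement_count_codegree_expansion)
qed

text \<open>
  Relative to \<open>2 * q\<close>, the part of codegree \<open>2 * s\<close> contributes to codegree \<open>i\<close> its own coefficient of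
  codegree \<open>i - 2 * s\<close>.  So only \<open>s \<le> i div 2\<close> matter, a range independent of \<open>q\<close>; if it exceeds \<open>q\<close>, the
  extra coefficients vanish at \<open>q\<close>.
\<close>

lemma codegree_coeff_count_poly:
  "codegree_coeff (2 * q) (count_poly q) i =
     poly ([:of_bool (i = 0):] + (\<Sum>s=1..i div 2. part_coeff s (i - 2 * s))) (of_nat q)"
proof -
  define u where "u s = poly (part_coeff s (i - 2 * s)) (of_nat q)" for s
  have u0: "u s = 0" if "q < s" for s
    unfolding u_def codegree_coeff_part_poly[symmetric]
    using that by (simp add: part_poly_eq_0 codegree_coeff_def)
  have part: "codegree_coeff (2 * q) (part_poly s q) i = (if i < 2 * s then 0 else u s)"
    if "s \<le> q" for s
    using codegree_coeff_shift[OF degree_part_poly[OF that], of "2 * s" i] that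
    by (simp add: u_def codegree_coeff_part_poly)
  have "codegree_coeff (2 * q) (count_poly q) i =
      codegree_coeff (2 * q) (monom 1 (2 * q)) i + (\<Sum>s=1..q. codegree_coeff (2 * q) (part_poly s q) i)"
    unfolding codegree_coeff_sum[symmetric] count_poly_def by (simp add: codegree_coeff_def)
  also have "codegree_coeff (2 * q) (monom 1 (2 * q)) i = of_bool (i = 0)"
    by (auto simp: codegree_coeff_def)
  also have "(\<Sum>s=1..q. codegree_coeff (2 * q) (part_poly s q) i) =
      (\<Sum>s=1..q. if i < 2 * s then 0 else u s)"
    by (intro sum.cong refl part) simp
  also have "\<dots> = (\<Sum>s\<in>{s \<in> {1..q}. 2 * s \<le> i}. u s)"
    by (subst sum.inter_filter) (auto intro!: sum.cong)
  also have "\<dots> = (\<Sum>s=1..i div 2. u s)"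
    by (rule sum.mono_neutral_left) (auto intro: u0)
  finally show ?thesis
    by (simp add: u_def poly_sum)
qed

lemma degree_count_poly: "degree (count_poly q) = 2 * q" "count_poly q \<noteq> 0"
proof -
  have "degree (part_poly s q) \<le> 2 * q" if "s \<in> {1..q}" for s
    using degree_part_poly[of s q] that by simp
  then have le: "degree (count_poly q) \<le> 2 * q"
    unfolding count_poly_def
    by (intro degree_add_le degree_sum_le degree_monom_le) auto
  have "coeff (count_poly q) (2 * q) = 1"
    using codegree_coeff_count_poly[of q 0] by (simp add: codegree_coeff_def)
  then show "degree (count_poly q) = 2 * q" "count_poly q \<noteq> 0"
    using le le_degree[of "count_poly q" "2 * q"] by auto
qed

lemma eventually_count_poly:
  "\<forall>\<^sub>F n in sequentially. placement_count M q n = poly (count_poly q) (of_nat n)"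
  by (rule eventually_sequentiallyI[of "max_coord M * q"]) (simp add: poly_count_poly)

lemma eventual_two_level_placement_count:
  "eventual_two_level_polynomial [:0, 2:] (infinite_depth [:0, 2:]) (placement_count M)"
proof -
  have g: "[:0, 2:] = [:- of_nat 0, 2 :: rat:]" by simp
  let ?\<phi> = "\<lambda>i. [:of_bool (i = 0):] + (\<Sum>s=1..i div 2. part_coeff s (i - 2 * s))"
  show ?thesis
    unfolding g eventual_two_level_polynomial_def polynomial_codegree_coeffs_def
      linear_index_set linear_degree_at
  proof (intro conjI, goal_cases)
    case 4
    show ?case
    proof (rule exI[of _ count_poly], rule conjI)
      show "\<exists>\<phi>. \<forall>q\<in>{q. 0 \<le> 2 * q}. \<forall>r. Fin (int r) \<le> infinite_depth [:- of_nat 0, 2:] q \<longrightarrow>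
          codegree_coeff (2 * q - 0) (count_poly q) r = poly (\<phi> r) (of_nat q)"
        by (rule exI[of _ ?\<phi>]) (simp only: diff_zero codegree_coeff_count_poly simp_thms ball_simps)
      show "\<forall>q\<in>{q. 0 \<le> 2 * q}. degree (count_poly q) \<le> 2 * q - 0 \<and>
          (\<forall>\<^sub>F n in sequentially. placement_count M q n = poly (count_poly q) (of_nat n))"
        using degree_count_poly(1) eventually_count_poly by simp
    qed
  qed (use linear_degree_function[of 0] infinite_depth_depth_function in simp_all)
qed

abbreviation "entry r t \<equiv> L (r div 2) ! (t - 1)"

text \<open>
  The integer exponent of \<open>n\<close> in \<open>codegree_term\<close> is \<open>2 * (q - k)\<close> for \<open>k \<le> q\<close>, and otherwise the falling
  factorial is zero.
\<close>

lemma codegree_term_eq_codegree_part: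
  "codegree_term (\<lambda>r. length (L (r div 2))) (\<lambda>r t. fst (entry r t)) (\<lambda>r t. fst (snd (entry r t)))
     (\<lambda>r t. fst (snd (snd (entry r t)))) (\<lambda>r t. snd (snd (snd (entry r t)))) (2 * s) q n =
   codegree_part M s q n"
proof -
  define v where "v = (\<lambda>(k, c, C, as). falling q k / C *
    of_nat n powi (2 * int q - 2 * int c - int (2 * s)) * truncated_prod as n)"
  have v: "v t = term_value t q n" if "t \<in> set (L s)" for t
  proof -
    obtain k c C as where t: "t = (k, c, C, as)" by (cases t)
    have k: "k = c + s" using valid[OF that] by (simp add: t valid_term_def)
    show ?thesis
    proof (cases "k \<le> q")
      case True
      then have "2 * int q - 2 * int c - int (2 * s) = int (2 * (q - k))" using k by simp
      then show ?thesis
        unfolding v_def term_value_def t prod.case by (simp only: power_int_of_nat)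
    next
      case False
      then have "falling q k = 0" by (simp add: falling_eq_0_iff)
      then show ?thesis by (simp add: v_def term_value_def t)
    qed
  qed
  have "(\<Sum>t = 1..length (L s). v (L s ! (t - 1))) = (\<Sum>i<length (L s). v (L s ! i))"
    by (simp add: sum.atLeast1_atMost_eq)
  also have "\<dots> = (\<Sum>t\<leftarrow>L s. v t)"
    by (simp add: sum_list_sum_nth atLeast0LessThan)
  also have "\<dots> = codegree_part M s q n"
    unfolding part by (intro arg_cong[where f = sum_list] map_cong refl v)
  finally show ?thesis
    by (simp add: codegree_term_def v_def case_prod_beta)
qed

end

theorem theorem55:
  fixes M :: "(int \<times> int) set"
  assumes "finite M"
  shows "eventual_two_level_polynomial [:0, 2:] (infinite_depth [:0, 2:]) (placement_count M) \<and>
    (\<forall>q. \<exists>p :: rat poly. p \<noteq> 0 \<and> degree p = 2 * q \<and>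
       (\<forall>\<^sub>F n in sequentially. placement_count M q n = poly p (of_nat n))) \<and>
    (\<exists>(m :: nat \<Rightarrow> nat) (k :: nat \<Rightarrow> nat \<Rightarrow> nat) (c :: nat \<Rightarrow> nat \<Rightarrow> nat)
       (C :: nat \<Rightarrow> nat \<Rightarrow> rat) (a :: nat \<Rightarrow> nat \<Rightarrow> nat list).
       (\<forall>r t. even r \<and> 2 \<le> r \<and> t \<in> {1..m r} \<longrightarrow>
          C r t \<noteq> 0 \<and> length (a r t) = 2 * c r t \<and>
          (\<forall>x\<in>set (a r t). 2 * x \<le> max_coord M * r) \<and>
          (\<forall>q. falling q (k r t) \<noteq> 0 \<longrightarrow> 2 * c r t + r \<le> 2 * q)) \<and>
       (\<forall>q n. placement_count M q n =
          of_nat n ^ (2 * q) +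
          (\<Sum>r | even r \<and> 2 \<le> r \<and> r \<le> 2 * q. codegree_term m k c C a r q n)) \<and>
       (\<forall>r. even r \<and> 2 \<le> r \<longrightarrow>
          (\<exists>h. two_level_polynomial [:- of_nat r, 2:] (infinite_depth [:- of_nat r, 2:]) h \<and>
             (\<forall>q n. max_coord M * r \<le> 2 * n \<longrightarrow>
                codegree_term m k c C a r q n = poly (h q) (of_nat n)))))"
proof -
  have "\<forall>s. \<exists>L. (\<forall>t\<in>set L. valid_term (max_coord M * s) s t) \<and>
      (\<forall>q n. codegree_part M s q n = (\<Sum>t\<leftarrow>L. term_value t q n))"
    using codegree_part_terms[OF assms] by blast
  from choice[OF this] obtain L where L: "\<forall>s. (\<forall>t\<in>set (L s). valid_term (max_coord M * s) s t) \<and>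
      (\<forall>q n. codegree_part M s q n = (\<Sum>t\<leftarrow>L s. term_value t q n))" ..
  interpret codegree_terms M L
    by unfold_locales (use L in blast)+
  let ?m = "\<lambda>r. length (L (r div 2))"
  let ?k = "\<lambda>r t. fst (entry r t)"
  let ?c = "\<lambda>r t. fst (snd (entry r t))"
  let ?C = "\<lambda>r t. fst (snd (snd (entry r t)))"
  let ?a = "\<lambda>r t. snd (snd (snd (entry r t)))"
  let ?T = "codegree_term ?m ?k ?c ?C ?a"
  have terms: "?C r t \<noteq> 0 \<and> length (?a r t) = 2 * ?c r t \<and>
      (\<forall>x\<in>set (?a r t). 2 * x \<le> max_coord M * r) \<and>
      (\<forall>q. falling q (?k r t) \<noteq> 0 \<longrightarrow> 2 * ?c r t + r \<le> 2 * q)"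
    if rt: "even r \<and> 2 \<le> r \<and> t \<in> {1..?m r}" for r t
  proof -
    obtain s where r: "r = 2 * s" using rt by (auto elim: evenE)
    have "entry r t \<in> set (L s)"
    proof -
      have "t - 1 < length (L s)" using rt unfolding r by auto
      then show ?thesis unfolding r by simp
    qed
    then have "valid_term (max_coord M * s) s (entry r t)"
      by (rule valid)
    then show ?thesis
      by (auto simp: valid_term_def case_prod_beta falling_eq_0_iff r)
  qed
  have expansion: "placement_count M q n = of_nat n ^ (2 * q) +
      (\<Sum>r | even r \<and> 2 \<le> r \<and> r \<le> 2 * q. ?T r q n)" for q n
  proof -
    have "(\<Sum>r | even r \<and> 2 \<le> r \<and> r \<le> 2 * q. ?T r q n) = (\<Sum>s=1..q. ?T (2 * s) q n)"
      by (rule sum.reindex_bij_witness[where i = "\<lambda>s. 2 * s" and j = "\<lambda>r. r div 2"]) auto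
    then show ?thesis
      unfolding codegree_term_eq_codegree_part by (simp only: placement_count_codegree_expansion)
  qed
  have two_level: "\<exists>h. two_level_polynomial [:- of_nat r, 2:] (infinite_depth [:- of_nat r, 2:]) h \<and>
      (\<forall>q n. max_coord M * r \<le> 2 * n \<longrightarrow> ?T r q n = poly (h q) (of_nat n))"
    if even: "even r \<and> 2 \<le> r" for r
  proof -
    obtain s where r: "r = 2 * s" using even by (auto elim: evenE)
    have "?T r q n = poly (part_poly s q) (of_nat n)" if "max_coord M * r \<le> 2 * n" for q n
      unfolding r codegree_term_eq_codegree_part
      by (rule poly_part_poly[symmetric]) (use that r in simp)
    then show ?thesis
      unfolding r using two_level_part_poly[of s] by blast
  qed
  show ?thesis
  proof (intro conjI)
    show "eventual_two_level_polynomial [:0, 2:] (infinite_depth [:0, 2:]) (placement_count M)"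
      by (rule eventual_two_level_placement_count)
    show "\<forall>q. \<exists>p :: rat poly. p \<noteq> 0 \<and> degree p = 2 * q \<and>
       (\<forall>\<^sub>F n in sequentially. placement_count M q n = poly p (of_nat n))"
      using degree_count_poly eventually_count_poly by blast
  qed (rule exI[of _ ?m], rule exI[of _ ?k], rule exI[of _ ?c], rule exI[of _ ?C], rule exI[of _ ?a],
      use terms expansion two_level in blast)
qed

end
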